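(* Let $d\ge 1$, let $\gamma$ be the standard Gaussian measure on $\mathbb{R}^d$, and let $A\subset\mathbb{R}^d$ be a measurable set with $\gamma(A)>0$ and $\int_A x\,d\gamma=0$. For $r\ge 0$ let $A_r:=\{x\in\mathbb{R}^d: d(x,A)\le r\}$. Then for every $r\ge 0$, $$1-\gamma(A_r)\le \gamma(A)^{-1}e^{-r^2/2}.$$
   Context: The standard Gaussian measure $\gamma$ has density $(2\pi)^{-d/2}e^{-|x|^2/2}$ with respect to Lebesgue measure. $d(x,A)=\inf_{a\in A}|x-a|$ is the Euclidean distance from $x$ to $A$. *)

theory Defs
  imports "HOL-Analysis.Analysis"
begin

(* Based on lebesgue (the completion of lborel), so that the measurable sets are the
   Lebesgue measurable ones, Borel sets included. *)
definition std_gaussian :: "'a::euclidean_space measure" where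
  "std_gaussian =
     density lebesgue
       (\<lambda>x. ennreal ((2 * pi) powr (- real DIM('a) / 2) * exp (- (norm x)\<^sup>2 / 2)))"

(* infdist x A is the infimum of dist x a over a in A, except that infdist x {} = 0. *)
definition nbhd :: "'a::metric_space set \<Rightarrow> real \<Rightarrow> 'a set" where
  "nbhd A r = {x. infdist x A \<le> r}"

end

theory Submission
  imports Defs "HOL-Probability.Distributions"
begin

text \<open>
  With \<open>e(x) = exp(-|x|\<^sup>2/2)\<close>, put \<open>F = 1\<^sub>A e\<close>, and let \<open>G\<close> be \<open>exp(r\<^sup>2/2) e\<close> off \<open>A\<^sub>r\<close> and \<open>0\<close> on \<open>A\<^sub>r\<close>.
  Points off \<open>A\<^sub>r\<close> have distance at least \<open>r\<close> from \<open>A\<close>, so \<open>F(x) G(y) \<le> exp(-x\<cdot>y)\<close>, and \<open>F\<close> has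
  barycenter \<open>0\<close>. The functional Santalo inequality then gives \<open>\<integral>F \<integral>G \<le> (2\<pi>)\<^sup>d\<close>, which is the claim.

  The Santalo inequality is proved by Lehec's induction on the dimension. Split the mass of \<open>G\<close> in
  half by a hyperplane orthogonal to a coordinate axis, and take as new origin the point where the
  segment joining the barycenters of the two halves meets the hyperplane. Integrating each half of
  \<open>G\<close> along the direction of that segment leaves a function of barycenter \<open>0\<close> in one dimension less,
  to which the induction hypothesis applies; the inequality on the half-line contributes a factor
  \<open>\<pi>/2\<close> for each half. For \<open>F\<close> of barycenter \<open>0\<close>, moving the origin costs nothing:
  \<open>\<integral>F exp(z\<cdot>x) \<ge> \<integral>F (1 + z\<cdot>x) = \<integral>F\<close>.
\<close>

section \<open>The half-line\<close>

lemma nn_integral_inverse_Icc: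
  fixes a b :: real
  assumes "0 < a" "a \<le> b"
  shows "(\<integral>\<^sup>+s. ennreal (1 / s) * indicator {a..b} s \<partial>lborel) = ennreal (ln b - ln a)"
  using assms
  by (intro nn_integral_FTC_Icc) (auto intro!: derivative_eq_intros simp: field_simps)

text \<open>
  This is the Prekopa--Leindler step for the measure \<open>ds/s\<close>: since \<open>J\<close> is an interval, it is enough to
  compare the endpoints of \<open>A\<close>, \<open>B\<close> and \<open>J\<close> on the logarithmic scale.
\<close>

lemma log_length_level_sets:
  fixes A B J :: "real set"
  defines "L \<equiv> \<lambda>S. \<integral>\<^sup>+s. ennreal (1 / s) * indicator S s \<partial>lborel"
  assumes pos: "A \<subseteq> {0<..}" "B \<subseteq> {0<..}" and ne: "A \<noteq> {}" "B \<noteq> {}"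
    and J: "J \<subseteq> {p..q}" "0 < p" and J_conv: "\<And>x y. x \<in> J \<Longrightarrow> y \<in> J \<Longrightarrow> {x..y} \<subseteq> J"
    and mean: "\<And>a b. a \<in> A \<Longrightarrow> b \<in> B \<Longrightarrow> sqrt (a * b) \<in> J"
  shows "L A + L B \<le> 2 * L J"
proof -
  have mono: "L S \<le> L T" if "S \<subseteq> T" for S T
    unfolding L_def using that
    by (intro nn_integral_mono) (auto simp: indicator_def)
  have A0: "a > 0" if "a \<in> A" for a using pos that by auto
  have B0: "b > 0" if "b \<in> B" for b using pos that by auto
  obtain a0 b0 where ab: "a0 \<in> A" "b0 \<in> B" using ne by auto
  have "sqrt (a0 * b0) \<in> {p..q}" using mean[OF ab] J by auto
  then have pq: "p \<le> q" by auto
  \<comment> \<open>The bracket \<open>{p..q}\<close> makes \<open>L J\<close> finite, so that the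
    estimates below take place in the reals.\<close>
  have "L J \<le> L {p..q}" using mono J by auto
  also have "\<dots> = ennreal (ln q - ln p)" unfolding L_def using nn_integral_inverse_Icc J pq by auto
  finally have "L J < \<infinity>" by (simp add: le_less_trans)
  then obtain l where l: "L J = ennreal l" "0 \<le> l" by (cases "L J") auto
  \<comment> \<open>On the logarithmic scale geometric means become midpoints. The interval from the
    mean of \<open>a1\<close>, \<open>b1\<close> to the mean of \<open>a2\<close>, \<open>b2\<close>
    lies in \<open>J\<close>, and its logarithmic length is half the sum of the two
    displacements.\<close>
  have key: "ln a2 - ln a1 + ln b2 - ln b1 \<le> 2 * l"
    if "a1 \<in> A" "a2 \<in> A" "b1 \<in> B" "b2 \<in> B" for a1 a2 b1 b2
  proof -
    let ?x = "sqrt (a1 * b1)" and ?y = "sqrt (a2 * b2)"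
    have p: "a1 > 0" "a2 > 0" "b1 > 0" "b2 > 0" using that A0 B0 by auto
    have lnx: "ln ?x = (ln a1 + ln b1) / 2" "ln ?y = (ln a2 + ln b2) / 2"
      using p by (simp_all add: ln_sqrt ln_mult)
    have "ln ?y - ln ?x \<le> l"
    proof (cases "?x \<le> ?y")
      case True
      have "ennreal (ln ?y - ln ?x) = L {?x..?y}"
        unfolding L_def using True p by (subst nn_integral_inverse_Icc) auto
      also have "\<dots> \<le> L J" using mono J_conv[OF mean mean] that by auto
      finally show ?thesis using l by (simp add: ennreal_le_iff)
    next
      case False
      then have "ln ?y < ln ?x" using p by (subst ln_less_cancel_iff) auto
      then show ?thesis using l by simp
    qed
    then show ?thesis unfolding lnx by (simp add: field_simps)
  qed
  \<comment> \<open>Fixing three of the four points in \<open>key\<close> bounds the logarithm of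
    the fourth.\<close>
  have ul: "bdd_above (ln ` A)" "bdd_above (ln ` B)"
    using key[OF ab(1) _ ab(2) ab(2)] key[OF ab(1) ab(1) ab(2)]
    by - (rule bdd_aboveI2[where M = "2*l + ln a0"], force,
          rule bdd_aboveI2[where M = "2*l + ln b0"], force)
  have ll: "bdd_below (ln ` A)" "bdd_below (ln ` B)"
    using key[OF _ ab(1) ab(2) ab(2)] key[OF ab(1) ab(1) _ ab(2)]
    by - (rule bdd_belowI2[where m = "ln a0 - 2*l"], force,
          rule bdd_belowI2[where m = "ln b0 - 2*l"], force)
  define s i where "s = (\<lambda>S::real set. Sup (ln ` S))" and "i = (\<lambda>S::real set. Inf (ln ` S))"
  \<comment> \<open>\<open>key\<close> is extremised in one variable at a time: supremum over
    \<open>a2\<close>, then \<open>b2\<close>, then infimum over \<open>a1\<close>, then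
    \<open>b1\<close>. The outcome \<open>4\<close> compares the total logarithmic extent of
    \<open>A\<close> and \<open>B\<close> with \<open>2 * l\<close>.\<close>
  have 1: "s A \<le> 2 * l + ln a1 - ln b2 + ln b1" if "a1 \<in> A" "b1 \<in> B" "b2 \<in> B" for a1 b1 b2
    unfolding s_def using key[OF that(1) _ that(2,3)] ne by (intro cSUP_least) (auto simp: algebra_simps)
  have 2: "s B \<le> 2 * l + ln a1 - s A + ln b1" if "a1 \<in> A" "b1 \<in> B" for a1 b1
    using 1[OF that] ne unfolding s_def by (intro cSUP_least) (auto simp: algebra_simps)
  have 3: "s A + s B - 2 * l - ln b1 \<le> i A" if "b1 \<in> B" for b1
    unfolding i_def using 2[OF _ that] ne by (intro cINF_greatest) (auto simp: algebra_simps)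
  have 4: "s A + s B - 2 * l - i A \<le> i B"
    using 3 ne unfolding i_def by (intro cINF_greatest) (auto simp: algebra_simps)
  have bound: "i S \<le> s S \<and> L S \<le> ennreal (s S - i S)" if "S \<noteq> {}" "bdd_above (ln ` S)" "bdd_below (ln ` S)" "S \<subseteq> {0<..}"
    for S
  proof -
    have le: "i S \<le> s S" unfolding i_def s_def using that by (intro cInf_le_cSup) auto
    have "S \<subseteq> {exp (i S)..exp (s S)}"
    proof
      fix x assume x: "x \<in> S"
      then have "i S \<le> ln x" "ln x \<le> s S"
        unfolding i_def s_def using that by (auto intro: cINF_lower cSUP_upper)
      moreover have "x > 0" using x that by auto
      ultimately show "x \<in> {exp (i S)..exp (s S)}" by (metis atLeastAtMost_iff exp_le_cancel_iff exp_ln)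
    qed
    then have "L S \<le> L {exp (i S)..exp (s S)}" by (rule mono)
    also have "\<dots> = ennreal (s S - i S)" unfolding L_def using le by (subst nn_integral_inverse_Icc) auto
    finally show ?thesis using le by simp
  qed
  have "L A + L B \<le> ennreal (s A - i A) + ennreal (s B - i B)"
    using bound ne ul ll pos by (intro add_mono) auto
  also have "\<dots> = ennreal (s A - i A + (s B - i B))"
    using bound ne ul ll pos by (intro ennreal_plus[symmetric]) auto
  also have "\<dots> \<le> ennreal (2 * l)" using 4 by (intro ennreal_leI) auto
  also have "\<dots> = 2 * L J" using l by (simp add: ennreal_mult)
  finally show ?thesis .
qed

text \<open>Fubini: for fixed \<open>s\<close> the heights \<open>t\<close> in (0,1) below
  \<open>H s / c\<close> have total length \<open>min 1 (H s / c)\<close>. Dividing by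
  \<open>c\<close> puts functions with different suprema on one range of heights, so that level sets
  at equal \<open>t\<close> can be compared.\<close>

lemma log_layer_cake:
  fixes H :: "real \<Rightarrow> real"
  assumes [measurable]: "H \<in> borel_measurable borel" and H0: "\<And>s. s > 0 \<Longrightarrow> 0 \<le> H s" and c: "c > 0"
  shows "(\<integral>\<^sup>+t. indicator {0<..<1} t *
            (\<integral>\<^sup>+s. ennreal (1 / s) * indicator {s. 0 < s \<and> c * t < H s} s \<partial>lborel) \<partial>lborel) =
         (\<integral>\<^sup>+s. ennreal (min 1 (H s / c) / s) * indicator {0<..} s \<partial>lborel)"
proof -
  have "(\<integral>\<^sup>+t. indicator {0<..<1} t *
            (\<integral>\<^sup>+s. ennreal (1 / s) * indicator {s. 0 < s \<and> c * t < H s} s \<partial>lborel) \<partial>lborel) =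
        (\<integral>\<^sup>+t. (\<integral>\<^sup>+s. indicator {0<..<1} t * (ennreal (1 / s) * indicator {s. 0 < s \<and> c * t < H s} s) \<partial>lborel) \<partial>lborel)"
    by (intro nn_integral_cong nn_integral_cmult[symmetric]) measurable
  also have "\<dots> = (\<integral>\<^sup>+s. (\<integral>\<^sup>+t. indicator {0<..<1} t * (ennreal (1 / s) * indicator {s. 0 < s \<and> c * t < H s} s) \<partial>lborel) \<partial>lborel)"
    by (rule lborel_pair.Fubini') measurable
  also have "\<dots> = (\<integral>\<^sup>+s. ennreal (min 1 (H s / c) / s) * indicator {0<..} s \<partial>lborel)"
  proof (rule nn_integral_cong)
    fix s :: real
    show "(\<integral>\<^sup>+t. indicator {0<..<1} t * (ennreal (1 / s) * indicator {s. 0 < s \<and> c * t < H s} s) \<partial>lborel)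
      = ennreal (min 1 (H s / c) / s) * indicator {0<..} s"
    proof (cases "s > 0")
      case True
      have "(\<integral>\<^sup>+t. indicator {0<..<1} t * (ennreal (1 / s) * indicator {s. 0 < s \<and> c * t < H s} s) \<partial>lborel)
        = (\<integral>\<^sup>+t. ennreal (1 / s) * indicator {0<..<min 1 (H s / c)} t \<partial>lborel)"
        using True c by (intro nn_integral_cong) (auto simp: indicator_def field_simps)
      also have "\<dots> = ennreal (1 / s) * ennreal (min 1 (H s / c))"
        using H0[OF True] c by (subst nn_integral_cmult_indicator) auto
      finally show ?thesis using True H0[OF True] c by (simp flip: ennreal_mult)
    qed auto
  qed
  finally show ?thesis .
qed

section \<open>The Gaussian kernel r exp(-r^2/2) and the inequality on the half-line\<close>

lemma nn_integral_gaussian_halfline: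
  "(\<integral>\<^sup>+r. ennreal (exp (- r\<^sup>2 / 2)) * indicator {0<..} r \<partial>lborel) = ennreal (sqrt (pi / 2))"
proof -
  have "(\<integral>\<^sup>+r. ennreal (exp (- r\<^sup>2 / 2)) * indicator {0<..} r \<partial>lborel)
     = (\<integral>\<^sup>+r. ennreal (indicator {0..} r *\<^sub>R exp (- r\<^sup>2 / 2)) \<partial>lborel)"
    using AE_lborel_singleton[of "0::real"]
    by (intro nn_integral_cong_AE) (auto elim!: eventually_mono simp: indicator_def)
  also have "\<dots> = ennreal (sqrt 2) * (\<integral>\<^sup>+r. ennreal (indicator {0..} r *\<^sub>R exp (- r\<^sup>2)) \<partial>lborel)"
    by (subst nn_integral_real_affine[where c = "sqrt 2" and t = 0])
       (auto simp: power_mult_distrib indicator_def zero_le_mult_iff intro!: arg_cong2[where f = "(*)"] nn_integral_cong)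
  also have "(\<integral>\<^sup>+r. ennreal (indicator {0..} r *\<^sub>R exp (- r\<^sup>2)) \<partial>lborel) = ennreal (sqrt pi / 2)"
    using gaussian_moment_0 by (subst nn_integral_eq_integral) (auto simp: has_bochner_integral_iff)
  also have "ennreal (sqrt 2) * ennreal (sqrt pi / 2) = ennreal (sqrt (pi / 2))"
    by (subst ennreal_mult[symmetric]) (auto simp: real_sqrt_divide field_simps)
  finally show ?thesis .
qed

text \<open>Up to a constant the logarithm of the kernel is ln r - r^2/2, with derivative 1/r - r.
  It increases up to 1 and decreases afterwards, hence the superlevel sets are order-convex. These
  are the properties demanded of \<open>J\<close> in \<open>log_length_level_sets\<close>.\<close>

lemma gaussian_kernel_level_set:
  fixes K t :: real
  defines "J \<equiv> {r. 0 < r \<and> t < K * r * exp (- r\<^sup>2 / 2)}"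
  assumes Kt: "K > 0" "t > 0"
  shows "J \<subseteq> {t / K..2 * K / t}" and "\<And>x y. x \<in> J \<Longrightarrow> y \<in> J \<Longrightarrow> {x..y} \<subseteq> J"
proof
  fix r assume "r \<in> J"
  then have r: "r > 0" "t < K * r * exp (- r\<^sup>2 / 2)" by (auto simp: J_def)
  have "K * r * exp (- r\<^sup>2 / 2) \<le> K * r * 1" using r Kt by (intro mult_left_mono) auto
  then have "t \<le> r * K" using r by (simp only: mult_1_right mult.commute)
  then have 1: "t / K \<le> r" using \<open>K > 0\<close> by (simp add: field_simps)
  \<comment> \<open>This yields the decay K r exp(-r^2/2) <= 2 K / r, which bounds \<open>J\<close>
    on the right; the estimate above kept it away from 0.\<close>
  have "1 + r\<^sup>2 / 2 \<le> exp (r\<^sup>2 / 2)" by (rule exp_ge_add_one_self)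
  then have "r\<^sup>2 / 2 * exp (- r\<^sup>2 / 2) \<le> 1" by (simp add: exp_minus field_simps)
  then have "(2 * K / r) * (r\<^sup>2 / 2 * exp (- r\<^sup>2 / 2)) \<le> (2 * K / r) * 1"
    using r Kt by (intro mult_left_mono) auto
  moreover have "(2 * K / r) * (r\<^sup>2 / 2 * exp (- r\<^sup>2 / 2)) = K * r * exp (- r\<^sup>2 / 2)"
    using r by (simp add: power2_eq_square field_simps)
  ultimately have "t < 2 * K / r" using r by simp
  then have "r \<le> 2 * K / t" using r Kt by (simp add: field_simps)
  with 1 show "r \<in> {t / K..2 * K / t}" by simp
next
  fix x y assume xy: "x \<in> J" "y \<in> J"
  have alt: "r \<in> J \<longleftrightarrow> ln (t / K) < ln r - r\<^sup>2 / 2" if "r > 0" for r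
  proof -
    have "ln (K * r * exp (- r\<^sup>2 / 2)) = ln K + ln r - r\<^sup>2 / 2"
      using that Kt by (simp add: ln_mult)
    moreover have "t < K * r * exp (- r\<^sup>2 / 2) \<longleftrightarrow> ln t < ln (K * r * exp (- r\<^sup>2 / 2))"
      using that Kt by (subst ln_less_cancel_iff) auto
    ultimately show ?thesis using that Kt by (auto simp: J_def ln_div)
  qed
  show "{x..y} \<subseteq> J"
  proof
    fix z assume z: "z \<in> {x..y}"
    have xp: "x > 0" "y > 0" using xy by (auto simp: J_def)
    have dv: "((\<lambda>r. ln r - r\<^sup>2 / 2) has_real_derivative (1 / r - r)) (at r)" if "r > 0" for r :: real
      using that by (auto intro!: derivative_eq_intros)
    show "z \<in> J"
    \<comment> \<open>Left of the maximum at 1 the kernel at \<open>z\<close> is at least its value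
      at \<open>x\<close>; right of it, at least its value at \<open>y\<close>.\<close>
    proof (cases "z \<le> 1")
      case True
      have "ln x - x\<^sup>2 / 2 \<le> ln z - z\<^sup>2 / 2"
      proof (rule DERIV_nonneg_imp_nondecreasing[of x z "\<lambda>r. ln r - r\<^sup>2 / 2"])
        fix r assume "x \<le> r" "r \<le> z"
        then have "r > 0" "r \<le> 1" using xp True by auto
        then have "1 / r - r \<ge> 0" by (simp add: field_simps mult_le_one)
        then show "\<exists>d. ((\<lambda>r. ln r - r\<^sup>2 / 2) has_real_derivative d) (at r) \<and> d \<ge> 0"
          using dv \<open>r > 0\<close> by blast
      qed (use z in auto)
      then show ?thesis using alt[of z] alt[of x] xy xp z by auto
    next
      case False
      have "ln y - y\<^sup>2 / 2 \<le> ln z - z\<^sup>2 / 2"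
      proof (rule DERIV_nonpos_imp_nonincreasing[of z y "\<lambda>r. ln r - r\<^sup>2 / 2"])
        fix r assume "z \<le> r" "r \<le> y"
        then have "r \<ge> 1" using xp False by auto
        then have "r * r \<ge> 1" using mult_mono[of 1 r 1 r] by simp
        then have "1 / r - r \<le> 0" using \<open>r \<ge> 1\<close> by (simp add: field_simps)
        then show "\<exists>d. ((\<lambda>r. ln r - r\<^sup>2 / 2) has_real_derivative d) (at r) \<and> d \<le> 0"
          using dv[of r] \<open>r \<ge> 1\<close> by (meson less_le_trans zero_less_one)
      qed (use z in auto)
      then show ?thesis using alt[of z] alt[of y] xy xp z by auto
    qed
  qed
qed

text \<open>
  \<open>F s\<close> and \<open>G s\<close> stand for \<open>s * f s\<close> and \<open>s * g s\<close>, which turns \<open>ds\<close> into \<open>ds/s\<close> and the kernel into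
  \<open>s t exp(-s t)\<close>, the square of \<open>x exp(-x\<^sup>2/2)\<close> at the geometric mean \<open>x\<close> of \<open>s\<close> and \<open>t\<close>.
\<close>

lemma halfline_santalo_normalized:
  fixes F G :: "real \<Rightarrow> real"
  assumes [measurable]: "F \<in> borel_measurable borel" "G \<in> borel_measurable borel"
    and F: "\<And>s. s > 0 \<Longrightarrow> 0 \<le> F s \<and> F s \<le> \<alpha>" and G: "\<And>s. s > 0 \<Longrightarrow> 0 \<le> G s \<and> G s \<le> \<beta>"
    and supF: "\<And>c. c < \<alpha> \<Longrightarrow> \<exists>s>0. c < F s" and supG: "\<And>c. c < \<beta> \<Longrightarrow> \<exists>s>0. c < G s"
    and pos: "\<alpha> > 0" "\<beta> > 0" "C > 0"
    and FG: "\<And>s t. s > 0 \<Longrightarrow> t > 0 \<Longrightarrow> F s * G t \<le> C * (s * t) * exp (- (s * t))"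
  shows "(\<integral>\<^sup>+s. ennreal (F s / s) * indicator {0<..} s \<partial>lborel) *
         (\<integral>\<^sup>+s. ennreal (G s / s) * indicator {0<..} s \<partial>lborel) \<le> ennreal (C * pi / 2)"
proof -
  define L where "L = (\<lambda>c H t. \<integral>\<^sup>+s. ennreal (1 / s) * indicator {s. 0 < s \<and> c * t < (H s :: real)} s \<partial>lborel)"
  define I where "I = (\<lambda>c H. \<integral>\<^sup>+t. indicator {0<..<1} t * L c H t \<partial>lborel)"
  \<comment> \<open>\<open>K\<close> is chosen so that \<alpha> \<beta> \<open>\<theta> r\<close>
    squared, at r = sqrt(s t), is exactly the bound that \<open>FG\<close> puts on
    \<open>F s * G t\<close>.\<close>
  define K where "K = sqrt (C / (\<alpha> * \<beta>))"
  define \<theta> where "\<theta> = (\<lambda>r. K * r * exp (- r\<^sup>2 / 2))"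
  have K: "K > 0" "K\<^sup>2 = C / (\<alpha> * \<beta>)" using pos by (auto simp: K_def)
  have [measurable]: "\<theta> \<in> borel_measurable borel" by (simp add: \<theta>_def)
  have meas: "(\<lambda>t. L c H t) \<in> borel_measurable borel"
    if [measurable]: "H \<in> borel_measurable borel" for c H
    unfolding L_def by measurable
  have level: "L \<alpha> F t + L \<beta> G t \<le> 2 * L 1 \<theta> t" if t: "0 < t" "t < 1" for t
    unfolding L_def
  proof (rule log_length_level_sets)
    \<comment> \<open>The normalization enters here: \<alpha> and \<beta> are suprema, so every
      relative height \<open>t < 1\<close> is exceeded by both functions.\<close>
    show "{s. 0 < s \<and> \<alpha> * t < F s} \<noteq> {}" "{s. 0 < s \<and> \<beta> * t < G s} \<noteq> {}"
      using supF[of "\<alpha> * t"] supG[of "\<beta> * t"] t pos by auto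
    show "{s. 0 < s \<and> 1 * t < \<theta> s} \<subseteq> {t / K..2 * K / t}"
      using gaussian_kernel_level_set(1)[of K t] t K unfolding \<theta>_def by simp
    show "{x..y} \<subseteq> {s. 0 < s \<and> 1 * t < \<theta> s}"
      if "x \<in> {s. 0 < s \<and> 1 * t < \<theta> s}" "y \<in> {s. 0 < s \<and> 1 * t < \<theta> s}" for x y
      using gaussian_kernel_level_set(2)[of K t x y] that t K unfolding \<theta>_def by simp
    show "0 < t / K" using t K by simp
    fix a b assume "a \<in> {s. 0 < s \<and> \<alpha> * t < F s}" "b \<in> {s. 0 < s \<and> \<beta> * t < G s}"
    then have ab: "a > 0" "b > 0" "\<alpha> * t < F a" "\<beta> * t < G b" by auto
    have "(\<alpha> * t) * (\<beta> * t) < F a * G b"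
    proof (rule mult_strict_mono)
      show "0 < F a" using ab(3) mult_pos_pos[OF pos(1) t(1)] by linarith
      show "0 \<le> \<beta> * t" using pos t by simp
    qed (use ab in auto)
    also have "\<dots> \<le> C * (a * b) * exp (- (a * b))" using FG ab by auto
    finally have "t\<^sup>2 < K\<^sup>2 * (a * b) * exp (- (a * b))"
      using pos unfolding K by (simp add: field_simps power2_eq_square)
    also have "\<dots> = (\<theta> (sqrt (a * b)))\<^sup>2"
      using ab by (simp add: \<theta>_def power_mult_distrib exp_double[symmetric])
    finally have "t < \<theta> (sqrt (a * b))"
      by (rule power_less_imp_less_base) (use K ab in \<open>simp add: \<theta>_def\<close>)
    then show "sqrt (a * b) \<in> {s. 0 < s \<and> 1 * t < \<theta> s}" using ab by simp
  qed auto
  have "I 1 \<theta> = (\<integral>\<^sup>+s. ennreal (min 1 (\<theta> s / 1) / s) * indicator {0<..} s \<partial>lborel)"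
    unfolding I_def L_def using K by (intro log_layer_cake) (auto simp: \<theta>_def)
  \<comment> \<open>Dropping the cutoff at 1 lets the factor \<open>s\<close> of \<theta> cancel
    against 1/s, which leaves a half Gaussian.\<close>
  also have "\<dots> \<le> (\<integral>\<^sup>+s. ennreal K * (ennreal (exp (- s\<^sup>2 / 2)) * indicator {0<..} s) \<partial>lborel)"
    using K by (intro nn_integral_mono)
      (auto simp: indicator_def \<theta>_def min_def field_simps simp flip: ennreal_mult intro!: ennreal_leI)
  also have "\<dots> = ennreal K * ennreal (sqrt (pi / 2))"
    by (subst nn_integral_cmult) (auto simp: nn_integral_gaussian_halfline[simplified])
  also have "\<dots> = ennreal (K * sqrt (pi / 2))" using K by (simp add: ennreal_mult)
  finally have I\<theta>: "I 1 \<theta> \<le> ennreal (K * sqrt (pi / 2))" .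
  have "I \<alpha> F + I \<beta> G = (\<integral>\<^sup>+t. indicator {0<..<1} t * (L \<alpha> F t + L \<beta> G t) \<partial>lborel)"
    unfolding I_def using meas by (subst nn_integral_add[symmetric]) (auto simp: distrib_left)
  also have "\<dots> \<le> (\<integral>\<^sup>+t. 2 * (indicator {0<..<1} t * L 1 \<theta> t) \<partial>lborel)"
    using level by (intro nn_integral_mono) (auto simp: indicator_def)
  also have "\<dots> = 2 * I 1 \<theta>" unfolding I_def using meas by (intro nn_integral_cmult) auto
  also have "\<dots> \<le> 2 * ennreal (K * sqrt (pi / 2))" using I\<theta> by (rule mult_left_mono) simp
  also have "\<dots> = ennreal (2 * (K * sqrt (pi / 2)))" using K by (simp add: ennreal_mult)
  finally have sum: "I \<alpha> F + I \<beta> G \<le> ennreal (2 * (K * sqrt (pi / 2)))" .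
  then have "I \<alpha> F + I \<beta> G < \<infinity>" by (rule le_less_trans) simp
  then obtain x y where xy: "I \<alpha> F = ennreal x" "I \<beta> G = ennreal y" "0 \<le> x" "0 \<le> y"
    by (cases "I \<alpha> F"; cases "I \<beta> G") auto
  have "x + y \<le> 2 * (K * sqrt (pi / 2))"
  proof -
    have "ennreal (x + y) \<le> ennreal (2 * (K * sqrt (pi / 2)))" using sum unfolding xy(1,2) ennreal_plus[OF xy(3,4)] .
    then show ?thesis using K by (subst (asm) ennreal_le_iff) auto
  qed
  then have "(x + y)\<^sup>2 \<le> (2 * (K * sqrt (pi / 2)))\<^sup>2" using xy by (intro power_mono) auto
  also have "\<dots> = 4 * (K\<^sup>2 * (pi / 2))" by (simp add: power_mult_distrib)
  finally have "(x + y)\<^sup>2 \<le> 4 * (K\<^sup>2 * (pi / 2))" .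
  \<comment> \<open>Arithmetic-geometric mean: the bound on the sum \<open>x + y\<close> becomes one
    on the product.\<close>
  moreover have "4 * (x * y) = (x + y)\<^sup>2 - (x - y)\<^sup>2" by (simp add: power2_eq_square algebra_simps)
  moreover have "0 \<le> (x - y)\<^sup>2" by simp
  ultimately have prod: "x * y \<le> K\<^sup>2 * (pi / 2)" by linarith
  \<comment> \<open>This undoes the normalization; \<open>H\<close> is at most \<open>c\<close> on
    the half-line, so the minimum in \<open>log_layer_cake\<close> is
    \<open>H s / c\<close>.\<close>
  have conv: "(\<integral>\<^sup>+s. ennreal (H s / s) * indicator {0<..} s \<partial>lborel) = ennreal c * I c H"
    if [measurable]: "H \<in> borel_measurable borel" and H: "\<And>s. s > 0 \<Longrightarrow> 0 \<le> H s \<and> H s \<le> c" and c: "c > 0" for c H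
  proof -
    have "I c H = (\<integral>\<^sup>+s. ennreal (min 1 (H s / c) / s) * indicator {0<..} s \<partial>lborel)"
      unfolding I_def L_def using H c by (intro log_layer_cake) auto
    then have "ennreal c * I c H = (\<integral>\<^sup>+s. ennreal c * (ennreal (min 1 (H s / c) / s) * indicator {0<..} s) \<partial>lborel)"
      by (simp add: nn_integral_cmult)
    also have "\<dots> = (\<integral>\<^sup>+s. ennreal (H s / s) * indicator {0<..} s \<partial>lborel)"
    proof (rule nn_integral_cong)
      fix s :: real
      have "min 1 (H s / c) = H s / c" if "s > 0" using H[OF that] c by simp
      then show "ennreal c * (ennreal (min 1 (H s / c) / s) * indicator {0<..} s)
          = ennreal (H s / s) * indicator {0<..} s"
        using H[of s] c by (cases "s > 0") (simp_all flip: ennreal_mult)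
    qed
    finally show ?thesis by simp
  qed
  have "(\<integral>\<^sup>+s. ennreal (F s / s) * indicator {0<..} s \<partial>lborel) *
         (\<integral>\<^sup>+s. ennreal (G s / s) * indicator {0<..} s \<partial>lborel) = ennreal (\<alpha> * x * (\<beta> * y))"
  proof -
    have "(\<integral>\<^sup>+s. ennreal (F s / s) * indicator {0<..} s \<partial>lborel) = ennreal (\<alpha> * x)"
      using conv[of F \<alpha>] F pos xy by (simp add: ennreal_mult)
    moreover have "(\<integral>\<^sup>+s. ennreal (G s / s) * indicator {0<..} s \<partial>lborel) = ennreal (\<beta> * y)"
      using conv[of G \<beta>] G pos xy by (simp add: ennreal_mult)
    ultimately show ?thesis using pos xy by (simp add: ennreal_mult)
  qed
  also have "\<dots> \<le> ennreal (C * pi / 2)"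
    using mult_left_mono[OF prod, of "\<alpha> * \<beta>"] pos K by (intro ennreal_leI) (simp add: field_simps)
  finally show ?thesis .
qed

text \<open>Multiplying \<open>f\<close> and \<open>g\<close> by their variable leads to the
  normalized real-valued form. Infinite values are excluded on the way: since x exp(-x) <= 1, all
  products are at most \<open>C\<close>, so a supremum can be infinite only if the other function
  vanishes on the half-line, and then one integral is 0.\<close>

lemma halfline_santalo:
  fixes f g :: "real \<Rightarrow> ennreal"
  assumes [measurable]: "f \<in> borel_measurable borel" "g \<in> borel_measurable borel" and C: "C > 0"
    and fg: "\<And>s t. s > 0 \<Longrightarrow> t > 0 \<Longrightarrow> f s * g t \<le> ennreal (C * exp (- (s * t)))"
  shows "(\<integral>\<^sup>+s. f s * indicator {0<..} s \<partial>lborel) * (\<integral>\<^sup>+s. g s * indicator {0<..} s \<partial>lborel)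
    \<le> ennreal (C * pi / 2)"
proof -
  define \<phi> \<psi> where "\<phi> = (\<lambda>s. ennreal s * f s)" and "\<psi> = (\<lambda>s. ennreal s * g s)"
  define a b where "a = (SUP s\<in>{0<..}. \<phi> s)" and "b = (SUP s\<in>{0<..}. \<psi> s)"
  have [measurable]: "\<phi> \<in> borel_measurable borel" "\<psi> \<in> borel_measurable borel"
    unfolding \<phi>_def \<psi>_def by measurable
  have prod: "\<phi> s * \<psi> t \<le> ennreal (C * (s * t) * exp (- (s * t)))" if "s > 0" "t > 0" for s t
  proof -
    have "\<phi> s * \<psi> t = ennreal (s * t) * (f s * g t)"
      using that by (simp add: \<phi>_def \<psi>_def ennreal_mult ac_simps)
    also have "\<dots> \<le> ennreal (s * t) * ennreal (C * exp (- (s * t)))"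
      using fg that by (intro mult_left_mono) auto
    also have "\<dots> = ennreal (C * (s * t) * exp (- (s * t)))"
      using that C by (simp add: ac_simps flip: ennreal_mult)
    finally show ?thesis .
  qed
  have prodC: "\<phi> s * \<psi> t \<le> ennreal C" if "s > 0" "t > 0" for s t
  proof -
    have "s * t * exp (- (s * t)) \<le> 1"
    proof -
      have "s * t \<le> exp (s * t)" using exp_ge_add_one_self[of "s * t"] by linarith
      then show ?thesis by (simp add: exp_minus field_simps)
    qed
    then have "C * (s * t) * exp (- (s * t)) \<le> C"
      using C mult_left_mono[of "s * t * exp (- (s * t))" 1 C] by (simp add: ac_simps)
    then show ?thesis using prod[OF that] by (meson ennreal_leI order_trans)
  qed
  have le: "\<phi> s \<le> a" "\<psi> s \<le> b" if "s > 0" for s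
    using that by (auto simp: a_def b_def intro!: SUP_upper)
  show ?thesis
  proof (cases "a = 0 \<or> b = 0")
    case True
    then have "(\<forall>s>0. f s = 0) \<or> (\<forall>s>0. g s = 0)"
      using le by (fastforce simp: \<phi>_def \<psi>_def)
    moreover have "(\<integral>\<^sup>+s. h s * indicator {0<..} s \<partial>lborel) = 0" if "\<forall>s>0. h s = 0" for h :: "real \<Rightarrow> ennreal"
      using that by (intro nn_integral_zero') (auto simp: indicator_def)
    ultimately show ?thesis by auto
  next
    case False
    have "a \<le> 0" if "\<forall>s>0. \<phi> s = 0" unfolding a_def using that by (intro SUP_least) auto
    moreover have "b \<le> 0" if "\<forall>s>0. \<psi> s = 0" unfolding b_def using that by (intro SUP_least) auto
    ultimately obtain s0 t0 where st0: "s0 > 0" "t0 > 0" "\<phi> s0 \<noteq> 0" "\<psi> t0 \<noteq> 0"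
      using False by auto
    \<comment> \<open>A point where \<psi> is nonzero turns the bound on products into finiteness of
      \<open>a\<close>; below, \<phi> does the same for \<open>b\<close>.\<close>
    have "\<psi> t0 * a = (SUP s\<in>{0<..}. \<psi> t0 * \<phi> s)"
      unfolding a_def by (simp add: SUP_mult_left_ennreal)
    also have "\<dots> \<le> ennreal C" using prodC st0 by (intro SUP_least) (auto simp: mult.commute)
    finally have "a \<noteq> top" using st0 by (auto simp: ennreal_mult_top top_unique)
    have "\<phi> s0 * b = (SUP s\<in>{0<..}. \<phi> s0 * \<psi> s)"
      unfolding b_def by (simp add: SUP_mult_left_ennreal)
    also have "\<dots> \<le> ennreal C" using prodC st0 by (intro SUP_least) auto
    finally have "b \<noteq> top" using st0 by (auto simp: ennreal_mult_top top_unique)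
    obtain \<alpha> where \<alpha>: "a = ennreal \<alpha>" "\<alpha> > 0" using \<open>a \<noteq> top\<close> False by (cases a) (auto simp: less_le)
    obtain \<beta> where \<beta>: "b = ennreal \<beta>" "\<beta> > 0" using \<open>b \<noteq> top\<close> False by (cases b) (auto simp: less_le)
    define F G where "F = (\<lambda>s. enn2real (\<phi> s))" and "G = (\<lambda>s. enn2real (\<psi> s))"
    have [measurable]: "F \<in> borel_measurable borel" "G \<in> borel_measurable borel"
      unfolding F_def G_def by measurable
    have F: "\<phi> s = ennreal (F s)" and G: "\<psi> s = ennreal (G s)" if "s > 0" for s
    proof -
      have "\<phi> s < top" "\<psi> s < top"
        using le[OF that] \<alpha> \<beta> by (auto intro: le_less_trans)
      then show "\<phi> s = ennreal (F s)" "\<psi> s = ennreal (G s)" by (simp_all add: F_def G_def)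
    qed
    have F0: "0 \<le> F s" "0 \<le> G s" for s by (auto simp: F_def G_def)
    have "(\<integral>\<^sup>+s. ennreal (F s / s) * indicator {0<..} s \<partial>lborel) *
         (\<integral>\<^sup>+s. ennreal (G s / s) * indicator {0<..} s \<partial>lborel) \<le> ennreal (C * pi / 2)"
    proof (rule halfline_santalo_normalized[where \<alpha> = \<alpha> and \<beta> = \<beta>])
      fix s :: real assume s: "s > 0"
      show "0 \<le> F s \<and> F s \<le> \<alpha>" "0 \<le> G s \<and> G s \<le> \<beta>"
        using le[OF s] F[OF s] G[OF s] F0[of s] \<alpha> \<beta> by (simp_all add: ennreal_le_iff)
      fix t :: real assume t: "t > 0"
      have "ennreal (F s * G t) \<le> ennreal (C * (s * t) * exp (- (s * t)))"
        using prod[OF s t] F0 unfolding F[OF s] G[OF t] by (simp add: ennreal_mult)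
      then show "F s * G t \<le> C * (s * t) * exp (- (s * t))"
        using s t C by (subst (asm) ennreal_le_iff) auto
    next
      fix c assume "c < \<alpha>"
      then have "ennreal (max c 0) < a" using \<alpha> by (simp add: ennreal_lessI)
      then obtain s where s: "s > 0" "ennreal (max c 0) < \<phi> s" unfolding a_def less_SUP_iff by auto
      then show "\<exists>s>0. c < F s" using F[of s] by (auto simp: ennreal_less_iff)
    next
      fix c assume "c < \<beta>"
      then have "ennreal (max c 0) < b" using \<beta> by (simp add: ennreal_lessI)
      then obtain s where s: "s > 0" "ennreal (max c 0) < \<psi> s" unfolding b_def less_SUP_iff by auto
      then show "\<exists>s>0. c < G s" using G[of s] by (auto simp: ennreal_less_iff)
    qed (use \<alpha> \<beta> C in auto)
    moreover have div: "u = ennreal (c / s)" if "s > 0" "ennreal s * u = ennreal c" "c \<ge> 0" for u and s c :: real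
      using that by (cases u) (auto simp: ennreal_mult_top field_simps simp flip: ennreal_mult)
    have "f s * indicator {0<..} s = ennreal (F s / s) * indicator {0<..} s"
      "g s * indicator {0<..} s = ennreal (G s / s) * indicator {0<..} s" for s
      using div[of s "f s" "F s"] div[of s "g s" "G s"] F[of s] G[of s] F0[of s]
      by (auto simp: indicator_def \<phi>_def \<psi>_def)
    ultimately show ?thesis by simp
  qed
qed

section \<open>Products of Lebesgue measure\<close>

lemma PiM_lborel_translate:
  fixes a :: "'i \<Rightarrow> real"
  assumes "finite J"
  shows "distr (PiM J (\<lambda>_. lborel)) (PiM J (\<lambda>_. lborel)) (\<lambda>x. \<lambda>i\<in>J. a i + x i) = PiM J (\<lambda>_. lborel)"
proof -
  interpret product_sigma_finite "\<lambda>_::'i. lborel :: real measure" ..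
  have sh: "emeasure lborel ((\<lambda>u. c + u) -` A) = emeasure lborel A" if "A \<in> sets borel" for A and c :: real
  proof -
    have "emeasure lborel A = emeasure (distr lborel borel (\<lambda>u. c + u)) A" by (simp add: lborel_distr_plus)
    also have "\<dots> = emeasure lborel ((\<lambda>u. c + u) -` A)" using that by (subst emeasure_distr) auto
    finally show ?thesis ..
  qed
  show ?thesis
  proof (rule PiM_eqI[OF assms])
    fix A :: "'i \<Rightarrow> real set" assume A: "\<And>i. i \<in> J \<Longrightarrow> A i \<in> sets lborel"
    have "emeasure (distr (PiM J (\<lambda>_. lborel)) (PiM J (\<lambda>_. lborel)) (\<lambda>x. \<lambda>i\<in>J. a i + x i)) (Pi\<^sub>E J A)
      = emeasure (PiM J (\<lambda>_. lborel)) ((\<lambda>x. \<lambda>i\<in>J. a i + x i) -` (Pi\<^sub>E J A) \<inter> space (PiM J (\<lambda>_. lborel)))"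
      using A assms by (intro emeasure_distr) (auto intro!: sets_PiM_I_finite)
    also have "(\<lambda>x. \<lambda>i\<in>J. a i + x i) -` (Pi\<^sub>E J A) \<inter> space (PiM J (\<lambda>_. lborel))
      = (\<Pi>\<^sub>E i\<in>J. (\<lambda>u. a i + u) -` A i)"
      by (auto simp: space_PiM PiE_iff)
    also have "emeasure (PiM J (\<lambda>_. lborel)) \<dots> = (\<Prod>i\<in>J. emeasure lborel ((\<lambda>u. a i + u) -` A i))"
      using A assms by (intro emeasure_PiM) (auto intro!: measurable_sets_borel[of _ borel])
    also have "\<dots> = (\<Prod>i\<in>J. emeasure lborel (A i))"
      using A sh by (intro prod.cong) auto
    finally show "emeasure (distr (PiM J (\<lambda>_. lborel)) (PiM J (\<lambda>_. lborel)) (\<lambda>x. \<lambda>i\<in>J. a i + x i)) (Pi\<^sub>E J A)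
      = (\<Prod>i\<in>J. emeasure lborel (A i))" .
  qed simp
qed

lemma nn_integral_PiM_translate:
  fixes f :: "('i \<Rightarrow> real) \<Rightarrow> ennreal"
  assumes "finite J" and [measurable]: "f \<in> borel_measurable (PiM J (\<lambda>_. lborel))"
  shows "(\<integral>\<^sup>+x. f (\<lambda>i\<in>J. a i + x i) \<partial>PiM J (\<lambda>_. lborel)) = (\<integral>\<^sup>+x. f x \<partial>PiM J (\<lambda>_. lborel))"
  by (subst (2) PiM_lborel_translate[OF assms(1), of a, symmetric]) (simp add: nn_integral_distr)

lemma integral_PiM_translate:
  fixes f :: "('i \<Rightarrow> real) \<Rightarrow> real"
  assumes "finite J" and [measurable]: "f \<in> borel_measurable (PiM J (\<lambda>_. lborel))"
  shows "(\<integral>x. f (\<lambda>i\<in>J. a i + x i) \<partial>PiM J (\<lambda>_. lborel)) = (\<integral>x. f x \<partial>PiM J (\<lambda>_. lborel))"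
  by (subst (2) PiM_lborel_translate[OF assms(1), of a, symmetric]) (simp add: integral_distr)

section \<open>Bisecting a mass on the line\<close>

text \<open>Intermediate value theorem for the primitive of \<open>h\<close>. The halves are written
  as integrals over \<open>s > 0\<close> along \<open>m + s\<close> and \<open>m - s\<close>, the
  form in which the half-line inequality meets them.\<close>

lemma bounded_density_median:
  fixes h :: "real \<Rightarrow> real"
  assumes h: "integrable lborel h" and h0: "\<And>x. 0 \<le> h x" and supp: "\<And>x. R < \<bar>x\<bar> \<Longrightarrow> h x = 0"
  shows "\<exists>m. (\<integral>\<^sup>+s. ennreal (h (m + s)) * indicator {0<..} s \<partial>lborel)
           = (\<integral>\<^sup>+s. ennreal (h (m - s)) * indicator {0<..} s \<partial>lborel)"
proof -
  have [measurable]: "h \<in> borel_measurable borel" using h by auto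
  have hk: "h integrable_on {a..b}" for a b :: real
    using set_borel_integral_eq_integral(1)[of "{a..b}" h] integrable_mult_indicator[OF _ h, of "{a..b}"]
    by (simp add: set_integrable_def)
  \<comment> \<open>\<open>R\<close> may be negative; \<open>R'\<close> is positive and
    \<open>h\<close> still vanishes outside \<open>{-R'..R'}\<close>.\<close>
  define R' where "R' = \<bar>R\<bar> + 1"
  have "continuous_on {-R'..R'} (\<lambda>x. integral {-R'..x} h)"
    by (rule indefinite_integral_continuous_1[OF hk])
  moreover have "0 \<le> integral {-R'..R'} h" using hk h0 by (intro integral_nonneg) auto
  ultimately have "\<exists>x. -R' \<le> x \<and> x \<le> R' \<and> integral {-R'..x} h = integral {-R'..R'} h / 2"
    using hk h0 by (intro IVT') (auto simp: R'_def)
  then obtain m where m: "-R' \<le> m" "m \<le> R'" "integral {-R'..m} h = integral {-R'..R'} h / 2" by auto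
  have eq: "integral {-R'..m} h = integral {m..R'} h"
    using Henstock_Kurzweil_Integration.integral_combine[OF m(1,2) hk] m(3) by simp
  have nn: "(\<integral>\<^sup>+x. ennreal (h x) * indicator {a..b} x \<partial>lborel) = ennreal (integral {a..b} h)" for a b
  proof -
    have si: "set_integrable lborel {a..b} h"
      unfolding set_integrable_def by (rule integrable_mult_indicator[OF _ h]) simp
    have "(\<integral>\<^sup>+x. ennreal (h x) * indicator {a..b} x \<partial>lborel) = (\<integral>\<^sup>+x. ennreal (indicator {a..b} x *\<^sub>R h x) \<partial>lborel)"
      by (intro nn_integral_cong) (auto simp: indicator_def)
    also have "\<dots> = ennreal (LINT x:{a..b}|lborel. h x)"
      unfolding set_lebesgue_integral_def using si h0 unfolding set_integrable_def
      by (intro nn_integral_eq_integral) auto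
    finally show ?thesis using set_borel_integral_eq_integral(2)[OF si] by simp
  qed
  have "(\<integral>\<^sup>+s. ennreal (h (m + s)) * indicator {0<..} s \<partial>lborel) = (\<integral>\<^sup>+x. ennreal (h x) * indicator {m<..} x \<partial>lborel)"
    by (subst nn_integral_real_affine[where c = 1 and t = m, of "\<lambda>x. ennreal (h x) * indicator {m<..} x"])
       (auto simp: indicator_def intro!: nn_integral_cong)
  also have "\<dots> = (\<integral>\<^sup>+x. ennreal (h x) * indicator {m..R'} x \<partial>lborel)"
    using AE_lborel_singleton[of m] supp
    by (intro nn_integral_cong_AE) (auto elim!: eventually_mono simp: indicator_def R'_def)
  also have "\<dots> = (\<integral>\<^sup>+x. ennreal (h x) * indicator {-R'..m} x \<partial>lborel)"
    unfolding nn eq ..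
  also have "\<dots> = (\<integral>\<^sup>+x. ennreal (h x) * indicator {..<m} x \<partial>lborel)"
    using AE_lborel_singleton[of m] supp
    by (intro nn_integral_cong_AE) (auto elim!: eventually_mono simp: indicator_def R'_def)
  also have "\<dots> = (\<integral>\<^sup>+s. ennreal (h (m - s)) * indicator {0<..} s \<partial>lborel)"
    by (subst nn_integral_real_affine[where c = "-1" and t = m, of "\<lambda>x. ennreal (h x) * indicator {..<m} x"])
       (auto simp: indicator_def intro!: nn_integral_cong)
  finally show ?thesis by blast
qed

section \<open>The functional Santalo inequality\<close>

abbreviation lebesgue_PiM :: "'i set \<Rightarrow> ('i \<Rightarrow> real) measure" where
  "lebesgue_PiM I \<equiv> PiM I (\<lambda>_. lborel)"

text \<open>The index set is a parameter so that induction can adjoin one coordinate at a time. The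
  constant is attained when \<open>f\<close> and \<open>g\<close> are both exp(-|x|^2/2).
  \<open>f\<close> is real because its barycenter is a Bochner integral, and integrability of the
  moments is demanded because a non-integrable function also has integral 0. \<open>g\<close> may
  have infinite values and an a priori infinite integral.\<close>

definition centered_santalo :: "'i set \<Rightarrow> bool" where
  "centered_santalo I \<longleftrightarrow>
    (\<forall>f g. integrable (lebesgue_PiM I) f \<longrightarrow> (\<forall>x. 0 \<le> f x) \<longrightarrow>
      (\<forall>i\<in>I. integrable (lebesgue_PiM I) (\<lambda>x. x i * f x) \<and> (\<integral>x. x i * f x \<partial>lebesgue_PiM I) = 0) \<longrightarrow>
      g \<in> borel_measurable (lebesgue_PiM I) \<longrightarrow>
      (\<forall>x\<in>space (lebesgue_PiM I). \<forall>y\<in>space (lebesgue_PiM I).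
         ennreal (f x) * g y \<le> ennreal (exp (- (\<Sum>i\<in>I. x i * y i)))) \<longrightarrow>
      (\<integral>\<^sup>+x. ennreal (f x) \<partial>lebesgue_PiM I) * (\<integral>\<^sup>+x. g x \<partial>lebesgue_PiM I) \<le> ennreal ((2 * pi) ^ card I))"

text \<open>Here the origin of \<open>g\<close> is chosen before \<open>f\<close>.\<close>

definition shifted_santalo :: "'i set \<Rightarrow> bool" where
  "shifted_santalo I \<longleftrightarrow>
    (\<forall>g C R. g \<in> borel_measurable (lebesgue_PiM I) \<longrightarrow> (\<forall>x. 0 \<le> g x \<and> g x \<le> C) \<longrightarrow>
      (\<forall>x\<in>space (lebesgue_PiM I). \<forall>i\<in>I. R < \<bar>x i\<bar> \<longrightarrow> g x = 0) \<longrightarrow>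
      (\<exists>z. \<forall>f. f \<in> borel_measurable (lebesgue_PiM I) \<longrightarrow>
        (\<forall>x\<in>space (lebesgue_PiM I). \<forall>y\<in>space (lebesgue_PiM I).
           f x * ennreal (g (\<lambda>i\<in>I. z i + y i)) \<le> ennreal (exp (- (\<Sum>i\<in>I. x i * y i)))) \<longrightarrow>
        (\<integral>\<^sup>+x. f x \<partial>lebesgue_PiM I) * (\<integral>\<^sup>+x. ennreal (g x) \<partial>lebesgue_PiM I) \<le> ennreal ((2 * pi) ^ card I)))"

section \<open>Integrability of bounded functions supported in a box\<close>

lemma sigma_finite_lebesgue_PiM: "finite I \<Longrightarrow> sigma_finite_measure (lebesgue_PiM I)"
  by (intro product_sigma_finite.sigma_finite) (simp_all add: product_sigma_finite_def sigma_finite_lborel)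

lemma emeasure_box_PiM:
  assumes "finite I"
  shows "emeasure (lebesgue_PiM I) (Pi\<^sub>E I (\<lambda>i. {- B i..B i})) < \<infinity>"
proof -
  interpret product_sigma_finite "\<lambda>_. lborel :: real measure" ..
  show ?thesis using assms by (subst emeasure_PiM) (auto simp: prod_ennreal emeasure_lborel_Icc_eq)
qed

lemma integrable_PiM_box:
  fixes \<Phi> :: "('i \<Rightarrow> real) \<Rightarrow> real"
  assumes "finite I" and [measurable]: "\<Phi> \<in> borel_measurable (lebesgue_PiM I)"
    and supp: "\<And>x i. x \<in> space (lebesgue_PiM I) \<Longrightarrow> i \<in> I \<Longrightarrow> B i < \<bar>x i\<bar> \<Longrightarrow> \<Phi> x = 0"
    and bnd: "\<And>x. x \<in> Pi\<^sub>E I (\<lambda>i. {- B i..B i}) \<Longrightarrow> \<bar>\<Phi> x\<bar> \<le> C"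
  shows "integrable (lebesgue_PiM I) \<Phi>"
proof (rule integrableI_bounded_set)
  show "Pi\<^sub>E I (\<lambda>i. {- B i..B i}) \<in> sets (lebesgue_PiM I)"
    using assms(1) by (intro sets_PiM_I_finite) auto
  show "AE x in lebesgue_PiM I. x \<in> Pi\<^sub>E I (\<lambda>i. {- B i..B i}) \<longrightarrow> norm (\<Phi> x) \<le> C"
    using bnd by auto
  show "AE x in lebesgue_PiM I. x \<notin> Pi\<^sub>E I (\<lambda>i. {- B i..B i}) \<longrightarrow> \<Phi> x = 0"
  proof (rule AE_I2, rule impI)
    fix x assume x: "x \<in> space (lebesgue_PiM I)" "x \<notin> Pi\<^sub>E I (\<lambda>i. {- B i..B i})"
    then obtain i where "i \<in> I" "x i \<notin> {- B i..B i}" by (auto simp: space_PiM PiE_iff)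
    then show "\<Phi> x = 0" using supp[OF x(1)] by auto
  qed
qed (use assms(1) emeasure_box_PiM in auto)

lemma integrable_pair_PiM_box:
  fixes \<Phi> :: "real \<times> ('i \<Rightarrow> real) \<Rightarrow> real"
  assumes "finite I" and [measurable]: "\<Phi> \<in> borel_measurable (lborel \<Otimes>\<^sub>M lebesgue_PiM I)"
    and supp: "\<And>s x i. x \<in> space (lebesgue_PiM I) \<Longrightarrow> i \<in> I \<Longrightarrow> B i < \<bar>x i\<bar> \<Longrightarrow> \<Phi> (s, x) = 0"
      "\<And>s x. x \<in> space (lebesgue_PiM I) \<Longrightarrow> R < \<bar>s\<bar> \<Longrightarrow> \<Phi> (s, x) = 0"
    and bnd: "\<And>s x. \<bar>s\<bar> \<le> R \<Longrightarrow> x \<in> Pi\<^sub>E I (\<lambda>i. {- B i..B i}) \<Longrightarrow> \<bar>\<Phi> (s, x)\<bar> \<le> C"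
  shows "integrable (lborel \<Otimes>\<^sub>M lebesgue_PiM I) \<Phi>"
proof (rule integrableI_bounded_set)
  let ?A = "{- R..R} \<times> Pi\<^sub>E I (\<lambda>i. {- B i..B i})"
  interpret sigma_finite_measure "lebesgue_PiM I" using assms(1) by (rule sigma_finite_lebesgue_PiM)
  have [measurable]: "Pi\<^sub>E I (\<lambda>i. {- B i..B i}) \<in> sets (lebesgue_PiM I)"
    using assms(1) by (intro sets_PiM_I_finite) auto
  show "?A \<in> sets (lborel \<Otimes>\<^sub>M lebesgue_PiM I)" by simp
  show "emeasure (lborel \<Otimes>\<^sub>M lebesgue_PiM I) ?A < \<infinity>"
    using emeasure_box_PiM[OF assms(1), of B]
    by (subst emeasure_pair_measure_Times) (auto simp: ennreal_mult_less_top emeasure_lborel_Icc_eq)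
  show "AE x in lborel \<Otimes>\<^sub>M lebesgue_PiM I. x \<in> ?A \<longrightarrow> norm (\<Phi> x) \<le> C"
    using bnd by (intro AE_I2) auto
  show "AE x in lborel \<Otimes>\<^sub>M lebesgue_PiM I. x \<notin> ?A \<longrightarrow> \<Phi> x = 0"
  proof (rule AE_I2, rule impI)
    fix x assume x: "x \<in> space (lborel \<Otimes>\<^sub>M lebesgue_PiM I)" "x \<notin> ?A"
    obtain s y where sy: "x = (s, y)" by (cases x)
    have y: "y \<in> space (lebesgue_PiM I)" using x sy by (simp add: space_pair_measure)
    have "R < \<bar>s\<bar> \<or> (\<exists>i\<in>I. B i < \<bar>y i\<bar>)" using x y unfolding sy by (force simp: space_PiM PiE_iff)
    then show "\<Phi> x = 0" using supp y unfolding sy by blast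
  qed
qed simp

text \<open>An empty product measure is a unit point mass and an empty sum is 0, so the pointwise
  hypothesis is already the conclusion.\<close>

lemma centered_santalo_empty: "centered_santalo ({} :: 'i set)"
proof -
  have "(\<integral>\<^sup>+x. h x \<partial>lebesgue_PiM {}) = h (\<lambda>_. undefined)" for h :: "('i \<Rightarrow> real) \<Rightarrow> ennreal"
    by (simp add: PiM_empty nn_integral_count_space_finite)
  then show ?thesis by (auto simp: centered_santalo_def)
qed

text \<open>\<open>g\<close> is truncated to bounded functions \<open>h n\<close> of bounded
  support. The origin \<open>z\<close> obtained for \<open>h n\<close> depends on \<open>n\<close>;
  it is absorbed by tilting \<open>f\<close> with exp(x.z), which does not decrease the integral of
  \<open>f\<close> as its barycenter is 0. Monotone convergence then removes the truncation.\<close>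

lemma shifted_imp_centered_santalo:
  assumes I: "finite I" and sh: "shifted_santalo I"
  shows "centered_santalo I"
  unfolding centered_santalo_def
proof (intro allI impI)
  let ?M = "lebesgue_PiM I"
  fix f :: "('a \<Rightarrow> real) \<Rightarrow> real" and g :: "('a \<Rightarrow> real) \<Rightarrow> ennreal"
  assume f: "integrable ?M f" and f0: "\<forall>x. 0 \<le> f x"
    and cent: "\<forall>i\<in>I. integrable ?M (\<lambda>x. x i * f x) \<and> (\<integral>x. x i * f x \<partial>?M) = 0"
    and g[measurable]: "g \<in> borel_measurable ?M"
    and fg: "\<forall>x\<in>space ?M. \<forall>y\<in>space ?M. ennreal (f x) * g y \<le> ennreal (exp (- (\<Sum>i\<in>I. x i * y i)))"
  have [measurable]: "f \<in> borel_measurable ?M" using f by auto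
  have [measurable]: "{x\<in>space ?M. \<forall>i\<in>I. \<bar>x i\<bar> \<le> real n} \<in> sets ?M" for n
    using I by measurable
  \<comment> \<open>Cutting at \<open>n\<close> before applying \<open>enn2real\<close> keeps the
    value finite; \<open>enn2real\<close> would send \<open>top\<close> to 0.\<close>
  define h where "h = (\<lambda>n x. enn2real (min (g x) (of_nat n)) * indicator {x\<in>space ?M. \<forall>i\<in>I. \<bar>x i\<bar> \<le> real n} x)"
  have [measurable]: "h n \<in> borel_measurable ?M" for n unfolding h_def by measurable
  have h_alt: "ennreal (h n x) = min (g x) (of_nat n) * indicator {x\<in>space ?M. \<forall>i\<in>I. \<bar>x i\<bar> \<le> real n} x" for n x
    unfolding h_def by (auto simp: indicator_def ennreal_enn2real_if min_def top_unique ennreal_of_nat_eq_real_of_nat split: if_splits)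
  have bound: "(\<integral>\<^sup>+x. ennreal (f x) \<partial>?M) * (\<integral>\<^sup>+x. ennreal (h n x) \<partial>?M) \<le> ennreal ((2 * pi) ^ card I)" for n
  proof -
    have "0 \<le> h n x \<and> h n x \<le> real n" for x
    proof -
      have "enn2real (min (g x) (of_nat n)) \<le> enn2real (of_nat n)"
        by (intro enn2real_mono) (auto simp: of_nat_less_top)
      then show ?thesis by (auto simp: h_def indicator_def)
    qed
    moreover have "h n x = 0" if "i \<in> I" "real n < \<bar>x i\<bar>" for x i
      using that by (force simp: h_def indicator_def)
    ultimately obtain z where z: "\<And>F. F \<in> borel_measurable ?M \<Longrightarrow>
        (\<forall>x\<in>space ?M. \<forall>y\<in>space ?M.
           F x * ennreal (h n (\<lambda>i\<in>I. z i + y i)) \<le> ennreal (exp (- (\<Sum>i\<in>I. x i * y i)))) \<Longrightarrow>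
        (\<integral>\<^sup>+x. F x \<partial>?M) * (\<integral>\<^sup>+x. ennreal (h n x) \<partial>?M) \<le> ennreal ((2 * pi) ^ card I)"
      using sh[unfolded shifted_santalo_def, rule_format, of "h n" "real n" "real n"] by auto
    \<comment> \<open>The tilt compensates the shift of the origin: exp(x.z) exp(-x.(z + y)) =
      exp(-x.y).\<close>
    define F where "F = (\<lambda>x. f x * exp (\<Sum>i\<in>I. x i * z i))"
    have [measurable]: "F \<in> borel_measurable ?M" unfolding F_def using I by measurable
    have F: "(\<integral>\<^sup>+x. ennreal (F x) \<partial>?M) * (\<integral>\<^sup>+x. ennreal (h n x) \<partial>?M) \<le> ennreal ((2 * pi) ^ card I)"
    proof (rule z; (intro ballI)?)
      fix x y assume xy: "x \<in> space ?M" "y \<in> space ?M"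
      have zy: "(\<lambda>i\<in>I. z i + y i) \<in> space ?M" by (simp add: space_PiM)
      have hg: "ennreal (h n w) \<le> g w" for w by (auto simp: h_alt indicator_def)
      have "ennreal (F x) * ennreal (h n (\<lambda>i\<in>I. z i + y i)) =
          ennreal (exp (\<Sum>i\<in>I. x i * z i)) * (ennreal (f x) * ennreal (h n (\<lambda>i\<in>I. z i + y i)))"
        using f0 by (simp add: F_def ennreal_mult ac_simps)
      also have "\<dots> \<le> ennreal (exp (\<Sum>i\<in>I. x i * z i)) * (ennreal (f x) * g (\<lambda>i\<in>I. z i + y i))"
        by (intro mult_left_mono hg) auto
      also have "\<dots> \<le> ennreal (exp (\<Sum>i\<in>I. x i * z i)) * ennreal (exp (- (\<Sum>i\<in>I. x i * (\<lambda>i\<in>I. z i + y i) i)))"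
        using xy zy by (intro mult_left_mono fg[rule_format]) auto
      also have "\<dots> = ennreal (exp (- (\<Sum>i\<in>I. x i * y i)))"
        by (simp add: distrib_left sum.distrib flip: ennreal_mult exp_add)
      finally show "ennreal (F x) * ennreal (h n (\<lambda>i\<in>I. z i + y i)) \<le> ennreal (exp (- (\<Sum>i\<in>I. x i * y i)))" .
    qed simp
    have "(\<integral>\<^sup>+x. ennreal (f x) \<partial>?M) \<le> (\<integral>\<^sup>+x. ennreal (F x) \<partial>?M)"
    proof -
      \<comment> \<open>\<open>?l\<close> is \<open>f\<close> times 1 + x.z, the tangent of the
        exponential at 0, and has the same integral as \<open>f\<close>. It may be negative, so its
        positive part is taken before passing to \<open>nn_integral\<close>.\<close>
      let ?l = "\<lambda>x. f x + (\<Sum>i\<in>I. z i * (x i * f x))"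
      have int: "integrable ?M ?l" using f cent by auto
      have "(\<integral>x. ?l x \<partial>?M) = (\<integral>x. f x \<partial>?M)" using f cent by (simp add: Bochner_Integration.integral_sum)
      then have "(\<integral>\<^sup>+x. ennreal (f x) \<partial>?M) = ennreal (\<integral>x. ?l x \<partial>?M)"
        using f f0 by (simp add: nn_integral_eq_integral)
      also have "\<dots> \<le> ennreal (\<integral>x. max 0 (?l x) \<partial>?M)"
        using int by (intro ennreal_leI integral_mono) auto
      also have "\<dots> = (\<integral>\<^sup>+x. ennreal (max 0 (?l x)) \<partial>?M)"
        using int by (intro nn_integral_eq_integral[symmetric]) auto
      also have "\<dots> \<le> (\<integral>\<^sup>+x. ennreal (F x) \<partial>?M)"
      proof (intro nn_integral_mono ennreal_leI)
        fix x
        have "?l x = f x * (1 + (\<Sum>i\<in>I. x i * z i))"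
          by (simp add: distrib_left sum_distrib_left ac_simps)
        also have "\<dots> \<le> F x" unfolding F_def using f0 exp_ge_add_one_self by (intro mult_left_mono) auto
        finally show "max 0 (?l x) \<le> F x" using f0 by (auto simp: F_def)
      qed
      finally show ?thesis .
    qed
    then show ?thesis by (rule order_trans[OF mult_right_mono F]) simp
  qed
  have "incseq (\<lambda>n x. ennreal (h n x))"
    unfolding h_alt
  proof (intro monoI le_funI mult_mono min.mono order_refl)
    fix m n :: nat and x assume "m \<le> n"
    then show "(of_nat m :: ennreal) \<le> of_nat n"
      "indicator {x\<in>space ?M. \<forall>i\<in>I. \<bar>x i\<bar> \<le> real m} x
        \<le> (indicator {x\<in>space ?M. \<forall>i\<in>I. \<bar>x i\<bar> \<le> real n} x :: ennreal)"
      by (auto simp: of_nat_mono indicator_def)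
  qed auto
  moreover have "(SUP n. ennreal (h n x)) = g x" if x: "x \<in> space ?M" for x
  proof (rule antisym)
    show "(SUP n. ennreal (h n x)) \<le> g x" unfolding h_alt by (intro SUP_least) (auto simp: indicator_def)
    \<comment> \<open>From \<open>n0\<close> on the point \<open>x\<close> lies in the truncation
      box, because the sum of the absolute values dominates each coordinate.\<close>
    obtain n0 :: nat where n0: "(\<Sum>i\<in>I. \<bar>x i\<bar>) \<le> real n0" using real_arch_simple by blast
    have le: "\<bar>x i\<bar> \<le> real n" if "i \<in> I" "n0 \<le> n" for i n
      using member_le_sum[of i I "\<lambda>i. \<bar>x i\<bar>"] that I n0 by force
    have hn: "min (g x) (of_nat n) \<le> (SUP n. ennreal (h n x))" for n
    proof -
      have "min (g x) (of_nat n) \<le> min (g x) (of_nat (max n n0))"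
        by (intro min.mono order_refl) (simp add: of_nat_mono)
      also have "\<dots> = ennreal (h (max n n0) x)"
        unfolding h_alt using x le by (auto simp: indicator_def)
      also have "\<dots> \<le> (SUP n. ennreal (h n x))" by (intro SUP_upper) auto
      finally show ?thesis .
    qed
    show "g x \<le> (SUP n. ennreal (h n x))"
    proof -
      have "g x = inf (g x) (SUP n. of_nat n)" by (simp add: ennreal_SUP_of_nat_eq_top)
      also have "\<dots> = (SUP n. inf (g x) (of_nat n))" by (rule inf_SUP)
      also have "\<dots> \<le> (SUP n. ennreal (h n x))" using hn by (intro SUP_least) (simp add: inf_min)
      finally show ?thesis .
    qed
  qed
  ultimately have "(\<integral>\<^sup>+x. g x \<partial>?M) = (SUP n. \<integral>\<^sup>+x. ennreal (h n x) \<partial>?M)"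
    by (subst nn_integral_monotone_convergence_SUP[symmetric]) (auto cong: nn_integral_cong)
  then have "(\<integral>\<^sup>+x. ennreal (f x) \<partial>?M) * (\<integral>\<^sup>+x. g x \<partial>?M) = (SUP n. (\<integral>\<^sup>+x. ennreal (f x) \<partial>?M) * (\<integral>\<^sup>+x. ennreal (h n x) \<partial>?M))"
    by (simp add: SUP_mult_left_ennreal)
  also have "\<dots> \<le> ennreal ((2 * pi) ^ card I)" using bound by (intro SUP_least) auto
  finally show "(\<integral>\<^sup>+x. ennreal (f x) \<partial>?M) * (\<integral>\<^sup>+x. g x \<partial>?M) \<le> ennreal ((2 * pi) ^ card I)" .
qed

section \<open>The induction step on the dimension\<close>

text \<open>After the shear the pairing of two points is s t + x.y, so the half-line inequality with
  constant exp(-x.y) bounds the product of the fibre integrals \<open>G y\<close> and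
  \<open>F x\<close> by (pi/2) exp(-x.y). The hypothesis \<open>bary\<close> says that
  \<open>G\<close> has barycenter 0. Thus \<open>cent\<close> applies with \<open>G\<close> in the
  role of the centered function and (2/pi) \<open>F\<close> in the other.\<close>

lemma half_space_santalo:
  fixes g :: "('i \<Rightarrow> real) \<Rightarrow> real" and f :: "('i \<Rightarrow> real) \<Rightarrow> ennreal" and \<sigma> m :: real and z v :: "'i \<Rightarrow> real"
  defines "a \<equiv> \<lambda>s i. z i + \<sigma> * s * v i"
  assumes J: "finite J" "k \<notin> J" and cent: "centered_santalo J" and \<sigma>: "\<sigma> = 1 \<or> \<sigma> = -1"
    and g[measurable]: "g \<in> borel_measurable (lebesgue_PiM (insert k J))"
    and gC: "\<And>x. 0 \<le> g x \<and> g x \<le> C"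
    and supp: "\<And>x i. x \<in> space (lebesgue_PiM (insert k J)) \<Longrightarrow> i \<in> insert k J \<Longrightarrow> R < \<bar>x i\<bar> \<Longrightarrow> g x = 0"
    and bary: "\<And>i. i \<in> J \<Longrightarrow> (\<integral>s. indicator {0<..} s *
        (\<integral>y. (y i - a s i) * g (y(k := m + \<sigma> * s)) \<partial>lebesgue_PiM J) \<partial>lborel) = 0"
    and f[measurable]: "f \<in> borel_measurable (lebesgue_PiM (insert k J))"
    and fg: "\<And>x y. x \<in> space (lebesgue_PiM (insert k J)) \<Longrightarrow> y \<in> space (lebesgue_PiM (insert k J)) \<Longrightarrow>
        f x * ennreal (g (\<lambda>i\<in>insert k J. (z(k := m)) i + y i)) \<le> ennreal (exp (- (\<Sum>i\<in>insert k J. x i * y i)))"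
  shows "(\<integral>\<^sup>+x. (\<integral>\<^sup>+t. f (x(k := \<sigma> * t - (\<Sum>i\<in>J. x i * v i))) * indicator {0<..} t \<partial>lborel) \<partial>lebesgue_PiM J)
     * (\<integral>\<^sup>+s. (\<integral>\<^sup>+y. ennreal (g (y(k := m + \<sigma> * s))) \<partial>lebesgue_PiM J) * indicator {0<..} s \<partial>lborel)
     \<le> ennreal (pi / 2 * (2 * pi) ^ card J)"
proof -
  let ?M = "lebesgue_PiM J" and ?I = "insert k J"
  interpret sf: sigma_finite_measure ?M using J(1) by (rule sigma_finite_lebesgue_PiM)
  interpret P: pair_sigma_finite lborel ?M ..
  \<comment> \<open>\<open>y\<close> is sheared by \<open>\<sigma> s v\<close> and the last coordinate of \<open>x\<close> by \<open>- x\<cdot>v\<close>, which together preserve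
      the inner product.\<close>
  define Q where "Q = (\<lambda>s y. indicator {0<..} s * g ((\<lambda>i\<in>J. a s i + y i)(k := m + \<sigma> * s)))"
  have [measurable]: "(\<lambda>w. (\<lambda>i\<in>J. a (fst w) i + snd w i)(k := m + \<sigma> * fst w))
      \<in> measurable (lborel \<Otimes>\<^sub>M ?M) (lebesgue_PiM ?I)"
    unfolding a_def
    by (rule measurable_fun_upd[where J = J]) (auto intro!: measurable_restrict)
  have Qm[measurable]: "(\<lambda>w. Q (fst w) (snd w)) \<in> borel_measurable (lborel \<Otimes>\<^sub>M ?M)"
    unfolding Q_def by measurable
  have Qm'[measurable]: "case_prod Q \<in> borel_measurable (lborel \<Otimes>\<^sub>M ?M)"
    using Qm by (simp add: case_prod_beta')
  have slice[measurable]: "(\<lambda>y. y(k := c)) \<in> measurable ?M (lebesgue_PiM ?I)" for c :: real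
    by (rule measurable_fun_upd[where J = J]) auto
  have spI: "y(k := c) \<in> space (lebesgue_PiM ?I)" if "y \<in> space ?M" for y and c :: real
    using measurable_space[OF slice that] .
  have spJ: "(\<lambda>i\<in>J. b i) \<in> space ?M" for b :: "'i \<Rightarrow> real" by (simp add: space_PiM)
  \<comment> \<open>Where \<open>Q\<close> is nonzero, |m + \<sigma> s| <= R, hence |s| <=
    \<open>S\<close>; and \<open>B i\<close> adds to |R| the largest shift |\<open>a s i\<close>|
    possible for such \<open>s\<close>.\<close>
  define S where "S = \<bar>R\<bar> + \<bar>m\<bar>"
  define B where "B = (\<lambda>i. \<bar>R\<bar> + \<bar>z i\<bar> + S * \<bar>v i\<bar>)"
  have Q0: "0 \<le> Q s y" for s y using gC by (simp add: Q_def)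
  have QC: "Q s y \<le> C" for s y
  proof -
    have "0 \<le> C" using gC[of undefined] by linarith
    then show ?thesis using gC by (simp add: Q_def indicator_def)
  qed
  have Qs: "Q s y = 0" if "S < \<bar>s\<bar>" for s y
  proof -
    have "R < \<bar>m + \<sigma> * s\<bar>" using that \<sigma> unfolding S_def by auto
    then have "g ((\<lambda>i\<in>J. a s i + y i)(k := m + \<sigma> * s)) = 0"
      by (intro supp[of _ k] spI spJ) auto
    then show ?thesis by (simp add: Q_def)
  qed
  have Qy: "Q s y = 0" if "i \<in> J" "B i < \<bar>y i\<bar>" for s y i
  proof (cases "S < \<bar>s\<bar>")
    case False
    have "\<bar>\<sigma> * s * v i\<bar> = \<bar>s\<bar> * \<bar>v i\<bar>" using \<sigma> by (auto simp: abs_mult)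
    also have "\<dots> \<le> S * \<bar>v i\<bar>" using False by (intro mult_right_mono) auto
    finally have "R < \<bar>a s i + y i\<bar>" using that(2) unfolding a_def B_def by linarith
    then have "g ((\<lambda>i\<in>J. a s i + y i)(k := m + \<sigma> * s)) = 0"
      using that(1) J(2) by (intro supp[of _ i] spI spJ) auto
    then show ?thesis by (simp add: Q_def)
  qed (rule Qs)
  have int_pair: "integrable (lborel \<Otimes>\<^sub>M ?M) (\<lambda>(s, y). Q s y)"
    by (rule integrable_pair_PiM_box[OF J(1), where B = B and R = S and C = C])
       (use Q0 QC Qs Qy in auto)
  have int_pair_i: "integrable (lborel \<Otimes>\<^sub>M ?M) (\<lambda>(s, y). y i * Q s y)" if i: "i \<in> J" for i
  proof (rule integrable_pair_PiM_box[OF J(1), where B = B and R = S and C = "B i * C"])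
    show "(\<lambda>(s, y). y i * Q s y) \<in> borel_measurable (lborel \<Otimes>\<^sub>M ?M)"
      using i by measurable
    show "\<bar>(\<lambda>(s, y). y i * Q s y) (s, x)\<bar> \<le> B i * C" if "x \<in> Pi\<^sub>E J (\<lambda>i. {- B i..B i})" for s x
    proof -
      have "\<bar>x i\<bar> \<le> B i" using that i by (auto simp: PiE_iff abs_le_iff)
      then show ?thesis using Q0[of s x] QC[of s x] by (auto simp: abs_mult intro!: mult_mono)
    qed
  qed (use Qs Qy in auto)
  define G where "G = (\<lambda>y. \<integral>s. Q s y \<partial>lborel)"
  have sec: "(\<lambda>s. Q s y) \<in> borel_measurable borel" if "y \<in> space ?M" for y
    using measurable_compose[OF measurable_Pair2'[OF that] Qm'] by simp
  have sec_int: "integrable lborel (\<lambda>s. Q s y)" if "y \<in> space ?M" for y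
    by (rule integrableI_bounded_set[where A = "{-S..S}" and B = C])
       (use sec[OF that] Q0 QC Qs in \<open>auto simp: emeasure_lborel_Icc_eq\<close>)
  have GQ: "ennreal (G y) = (\<integral>\<^sup>+s. ennreal (Q s y) \<partial>lborel)" if "y \<in> space ?M" for y
    unfolding G_def using sec_int[OF that] Q0 by (intro nn_integral_eq_integral[symmetric]) auto
  have G0: "0 \<le> G y" for y unfolding G_def using Q0 by (intro integral_nonneg_AE) auto
  have G_int: "integrable ?M G" unfolding G_def using P.integrable_snd[OF int_pair] .
  have G_int_i: "integrable ?M (\<lambda>y. y i * G y)" if "i \<in> J" for i
    using P.integrable_snd[OF int_pair_i[OF that]] by (simp add: G_def)
  have G_bary: "(\<integral>y. y i * G y \<partial>?M) = 0" if i: "i \<in> J" for i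
  proof -
    have "(\<integral>y. y i * G y \<partial>?M) = (\<integral>y. (\<integral>s. y i * Q s y \<partial>lborel) \<partial>?M)" by (simp add: G_def)
    also have "\<dots> = (\<integral>s. (\<integral>y. y i * Q s y \<partial>?M) \<partial>lborel)"
      by (rule P.Fubini_integral[OF int_pair_i[OF i]])
    \<comment> \<open>Translation by \<open>a s\<close> turns the plain moment of the shifted slice
      into the moment about \<open>a s\<close> that occurs in \<open>bary\<close>.\<close>
    also have "\<dots> = (\<integral>s. indicator {0<..} s * (\<integral>y. (y i - a s i) * g (y(k := m + \<sigma> * s)) \<partial>?M) \<partial>lborel)"
    proof (rule Bochner_Integration.integral_cong[OF refl])
      fix s :: real
      have "(\<integral>y. (y i - a s i) * g (y(k := m + \<sigma> * s)) \<partial>?M) =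
          (\<integral>y. ((\<lambda>i\<in>J. a s i + y i) i - a s i) * g ((\<lambda>i\<in>J. a s i + y i)(k := m + \<sigma> * s)) \<partial>?M)"
        using i by (intro integral_PiM_translate[OF J(1), symmetric]) measurable
      also have "\<dots> = (\<integral>y. y i * g ((\<lambda>i\<in>J. a s i + y i)(k := m + \<sigma> * s)) \<partial>?M)"
        using i by simp
      finally show "(\<integral>y. y i * Q s y \<partial>?M) = indicator {0<..} s * (\<integral>y. (y i - a s i) * g (y(k := m + \<sigma> * s)) \<partial>?M)"
        by (simp add: Q_def indicator_def)
    qed
    finally show ?thesis using bary[OF i] by simp
  qed
  have G_nn: "(\<integral>\<^sup>+y. ennreal (G y) \<partial>?M) =
     (\<integral>\<^sup>+s. (\<integral>\<^sup>+y. ennreal (g (y(k := m + \<sigma> * s))) \<partial>?M) * indicator {0<..} s \<partial>lborel)"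
  proof -
    have "(\<integral>\<^sup>+y. ennreal (G y) \<partial>?M) = (\<integral>\<^sup>+y. (\<integral>\<^sup>+s. ennreal (Q s y) \<partial>lborel) \<partial>?M)"
      using GQ by (rule nn_integral_cong)
    also have "\<dots> = (\<integral>\<^sup>+s. (\<integral>\<^sup>+y. ennreal (Q s y) \<partial>?M) \<partial>lborel)"
      by (rule P.Fubini') (use Qm' in measurable)
    also have "\<dots> = (\<integral>\<^sup>+s. (\<integral>\<^sup>+y. ennreal (g (y(k := m + \<sigma> * s))) \<partial>?M) * indicator {0<..} s \<partial>lborel)"
    proof (rule nn_integral_cong)
      fix s :: real
      have "(\<integral>\<^sup>+y. ennreal (g (y(k := m + \<sigma> * s))) \<partial>?M) =
         (\<integral>\<^sup>+y. ennreal (g ((\<lambda>i\<in>J. a s i + y i)(k := m + \<sigma> * s))) \<partial>?M)"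
        by (intro nn_integral_PiM_translate[OF J(1), symmetric]) measurable
      then show "(\<integral>\<^sup>+y. ennreal (Q s y) \<partial>?M) = (\<integral>\<^sup>+y. ennreal (g (y(k := m + \<sigma> * s))) \<partial>?M) * indicator {0<..} s"
        by (simp add: Q_def indicator_def)
    qed
    finally show ?thesis .
  qed
  have [measurable]: "(\<lambda>w. (fst w)(k := \<sigma> * snd w - (\<Sum>i\<in>J. fst w i * v i)))
      \<in> measurable (?M \<Otimes>\<^sub>M lborel) (lebesgue_PiM ?I)"
    by (rule measurable_fun_upd[where J = J]) auto
  define F where "F = (\<lambda>x. \<integral>\<^sup>+t. f (x(k := \<sigma> * t - (\<Sum>i\<in>J. x i * v i))) * indicator {0<..} t \<partial>lborel)"
  have f2: "(\<lambda>(x, t). f (x(k := \<sigma> * t - (\<Sum>i\<in>J. x i * v i))) * indicator {0<..} t) \<in> borel_measurable (?M \<Otimes>\<^sub>M lborel)"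
    unfolding case_prod_beta' by measurable
  have [measurable]: "F \<in> borel_measurable ?M"
    unfolding F_def using lborel.borel_measurable_nn_integral[OF f2] .
  have GF: "ennreal (G y) * (ennreal (2 / pi) * F x) \<le> ennreal (exp (- (\<Sum>i\<in>J. y i * x i)))"
    if xy: "y \<in> space ?M" "x \<in> space ?M" for x y
  proof -
    let ?e = "exp (- (\<Sum>i\<in>J. y i * x i))"
    let ?g = "\<lambda>s. ennreal (g ((\<lambda>i\<in>J. a s i + y i)(k := m + \<sigma> * s)))"
    let ?f = "\<lambda>t. f (x(k := \<sigma> * t - (\<Sum>i\<in>J. x i * v i)))"
    have "(\<integral>\<^sup>+s. ?g s * indicator {0<..} s \<partial>lborel) * (\<integral>\<^sup>+t. ?f t * indicator {0<..} t \<partial>lborel)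
      \<le> ennreal (?e * pi / 2)"
    proof (rule halfline_santalo)
      have "(\<lambda>s. (\<lambda>i\<in>J. a s i + y i)(k := m + \<sigma> * s)) \<in> measurable borel (lebesgue_PiM ?I)"
        unfolding a_def by (rule measurable_fun_upd[where J = J]) (auto intro!: measurable_restrict)
      then show "?g \<in> borel_measurable borel" by measurable
      have "(\<lambda>t. x(k := \<sigma> * t - (\<Sum>i\<in>J. x i * v i))) \<in> measurable borel (lebesgue_PiM ?I)"
        using xy by (intro measurable_fun_upd[where J = J]) auto
      then show "?f \<in> borel_measurable borel" by measurable
      fix s t :: real
      let ?c = "\<Sum>i\<in>J. x i * v i"
      let ?X = "x(k := \<sigma> * t - ?c)" and ?Y = "(\<lambda>i\<in>J. \<sigma> * s * v i + y i)(k := \<sigma> * s)"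
      have eqY: "(\<lambda>i\<in>?I. (z(k := m)) i + ?Y i) = (\<lambda>i\<in>J. a s i + y i)(k := m + \<sigma> * s)"
        using J(2) by (auto simp: a_def fun_eq_iff)
      \<comment> \<open>The two cross terms containing x.v cancel, and \<sigma> squared is
        1.\<close>
      have "(\<Sum>i\<in>?I. ?X i * ?Y i) = (\<sigma> * t - ?c) * (\<sigma> * s) + (\<Sum>i\<in>J. x i * (\<sigma> * s * v i + y i))"
        using J by (subst sum.insert) (auto intro!: sum.cong)
      also have "(\<Sum>i\<in>J. x i * (\<sigma> * s * v i + y i)) = \<sigma> * s * ?c + (\<Sum>i\<in>J. y i * x i)"
        by (simp add: distrib_left sum.distrib sum_distrib_left ac_simps)
      also have "(\<sigma> * t - ?c) * (\<sigma> * s) + (\<sigma> * s * ?c + (\<Sum>i\<in>J. y i * x i)) = s * t + (\<Sum>i\<in>J. y i * x i)"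
        using \<sigma> by (auto simp: algebra_simps)
      finally have ip: "(\<Sum>i\<in>?I. ?X i * ?Y i) = s * t + (\<Sum>i\<in>J. y i * x i)" .
      have "f ?X * ennreal (g (\<lambda>i\<in>?I. (z(k := m)) i + ?Y i)) \<le> ennreal (exp (- (\<Sum>i\<in>?I. ?X i * ?Y i)))"
        using xy by (intro fg spI spJ)
      then show "?g s * ?f t \<le> ennreal (?e * exp (- (s * t)))"
        unfolding eqY ip by (simp add: mult.commute exp_diff exp_minus field_simps flip: exp_add)
    qed simp
    moreover have "(\<integral>\<^sup>+s. ?g s * indicator {0<..} s \<partial>lborel) = ennreal (G y)"
      unfolding GQ[OF xy(1)] by (intro nn_integral_cong) (simp add: Q_def indicator_def)
    ultimately have "ennreal (G y) * F x \<le> ennreal (?e * pi / 2)" by (simp add: F_def)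
    then have "ennreal (2 / pi) * (ennreal (G y) * F x) \<le> ennreal (2 / pi) * ennreal (?e * pi / 2)"
      by (rule mult_left_mono) simp
    also have "\<dots> = ennreal ?e" by (subst ennreal_mult[symmetric]) auto
    finally show ?thesis by (simp add: ac_simps)
  qed
  have "(\<integral>\<^sup>+y. ennreal (G y) \<partial>?M) * (\<integral>\<^sup>+x. ennreal (2 / pi) * F x \<partial>?M) \<le> ennreal ((2 * pi) ^ card J)"
    using cent[unfolded centered_santalo_def, rule_format, of G "\<lambda>x. ennreal (2 / pi) * F x"]
      G_int G0 G_int_i G_bary GF by auto
  then have "ennreal (pi / 2) * ((\<integral>\<^sup>+y. ennreal (G y) \<partial>?M) * (\<integral>\<^sup>+x. ennreal (2 / pi) * F x \<partial>?M))
      \<le> ennreal (pi / 2) * ennreal ((2 * pi) ^ card J)"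
    by (rule mult_left_mono) simp
  also have "(\<integral>\<^sup>+x. ennreal (2 / pi) * F x \<partial>?M) = ennreal (2 / pi) * (\<integral>\<^sup>+x. F x \<partial>?M)"
    by (rule nn_integral_cmult) simp
  also have "ennreal (pi / 2) * ((\<integral>\<^sup>+y. ennreal (G y) \<partial>?M) * (ennreal (2 / pi) * (\<integral>\<^sup>+x. F x \<partial>?M)))
     = (ennreal (pi / 2) * ennreal (2 / pi)) * ((\<integral>\<^sup>+x. F x \<partial>?M) * (\<integral>\<^sup>+y. ennreal (G y) \<partial>?M))"
    by (simp add: ac_simps)
  also have "ennreal (pi / 2) * ennreal (2 / pi) = 1"
    by (subst ennreal_mult[symmetric]) auto
  also have "ennreal (pi / 2) * ennreal ((2 * pi) ^ card J) = ennreal (pi / 2 * (2 * pi) ^ card J)"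
    by (rule ennreal_mult[symmetric]) auto
  finally show ?thesis unfolding F_def G_nn by (simp only: mult_1_left)
qed

text \<open>The origin has \<open>k\<close>-th coordinate \<open>m\<close>, a median of the marginal
  \<open>h\<close> of \<open>g\<close>, and remaining coordinates \<open>z\<close>. The equality of
  the two masses is used twice: it simplifies the linear system for \<open>z\<close> and the slope
  \<open>v\<close>, and it lets the two half-space bounds be added with the common factor
  \<open>w 1\<close>.\<close>

lemma centered_imp_shifted_santalo_insert:
  assumes J: "finite J" "k \<notin> J" and cent: "centered_santalo J"
  shows "shifted_santalo (insert k J)"
  unfolding shifted_santalo_def
proof (intro allI impI)
  let ?M = "lebesgue_PiM J" and ?I = "insert k J"
  interpret product_sigma_finite "\<lambda>_. lborel :: real measure" ..
  interpret sf: sigma_finite_measure ?M using J(1) by (rule sigma_finite_lebesgue_PiM)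
  interpret P: pair_sigma_finite lborel ?M ..
  fix g :: "('a \<Rightarrow> real) \<Rightarrow> real" and C R
  assume g[measurable]: "g \<in> borel_measurable (lebesgue_PiM ?I)" and gC: "\<forall>x. 0 \<le> g x \<and> g x \<le> C"
    and supp: "\<forall>x\<in>space (lebesgue_PiM ?I). \<forall>i\<in>?I. R < \<bar>x i\<bar> \<longrightarrow> g x = 0"
  have pair_m[measurable]: "(\<lambda>w. (snd w)(k := c + \<sigma> * fst w)) \<in> measurable (lborel \<Otimes>\<^sub>M ?M) (lebesgue_PiM ?I)"
    for c \<sigma> :: real
    by (rule measurable_fun_upd[where J = J]) auto
  have slice[measurable]: "(\<lambda>y. y(k := c)) \<in> measurable ?M (lebesgue_PiM ?I)" for c :: real
    by (rule measurable_fun_upd[where J = J]) auto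
  have spI: "y(k := c) \<in> space (lebesgue_PiM ?I)" if "y \<in> space ?M" for y and c :: real
    using measurable_space[OF slice that] .
  have C0: "0 \<le> C" using gC order_trans by blast
  have R_k: "g (y(k := c)) = 0" if "R < \<bar>c\<bar>" "y \<in> space ?M" for y c
    using supp spI[OF that(2)] that by auto
  have R_J: "g (y(k := c)) = 0" if "R < \<bar>y i\<bar>" "i \<in> J" "y \<in> space ?M" for y c i
    using supp spI[OF that(3)] that J by (metis fun_upd_other insertI2)
  have int_slice: "integrable ?M (\<lambda>y. g (y(k := c)))" for c
    by (rule integrable_PiM_box[OF J(1), where B = "\<lambda>_. R" and C = C]) (use gC R_J in auto)
  have int_slice_i: "integrable ?M (\<lambda>y. y i * g (y(k := c)))" if i: "i \<in> J" for c i
  proof (rule integrable_PiM_box[OF J(1), where B = "\<lambda>_. R" and C = "R * C"])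
    show "(\<lambda>y. y i * g (y(k := c))) \<in> borel_measurable ?M" using i by measurable
    show "\<bar>x i * g (x(k := c))\<bar> \<le> R * C" if "x \<in> Pi\<^sub>E J (\<lambda>i. {- R..R})" for x
    proof -
      have "\<bar>x i\<bar> \<le> R" using that i by (auto simp: PiE_iff abs_le_iff)
      then show ?thesis using gC by (auto simp: abs_mult intro!: mult_mono)
    qed
  qed (use R_J in auto)
  define h where "h = (\<lambda>s. \<integral>y. g (y(k := s)) \<partial>?M)"
  have h0: "0 \<le> h s" for s unfolding h_def using gC by (intro integral_nonneg_AE) auto
  have hR: "h s = 0" if "R < \<bar>s\<bar>" for s
    unfolding h_def using R_k[OF that] by (simp cong: Bochner_Integration.integral_cong)
  have h_nn: "ennreal (h s) = (\<integral>\<^sup>+y. ennreal (g (y(k := s))) \<partial>?M)" for s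
    unfolding h_def using int_slice gC by (intro nn_integral_eq_integral[symmetric]) auto
  \<comment> \<open>The form \<open>0 + 1 * s\<close> matches the measurability rule
    \<open>pair_m\<close>; removing the two simplification rules preserves it.\<close>
  have int_pair: "integrable (lborel \<Otimes>\<^sub>M ?M) (\<lambda>(s, y). g (y(k := 0 + 1 * s)))"
    by (rule integrable_pair_PiM_box[OF J(1), where B = "\<lambda>_. R" and R = R and C = C])
       (use gC R_J R_k in \<open>auto simp: case_prod_beta' simp del: add_0_left mult_1_left\<close>)
  have h_int: "integrable lborel h"
    unfolding h_def using P.integrable_fst[OF int_pair] by simp
  obtain m where m: "(\<integral>\<^sup>+s. ennreal (h (m + s)) * indicator {0<..} s \<partial>lborel)
           = (\<integral>\<^sup>+s. ennreal (h (m - s)) * indicator {0<..} s \<partial>lborel)"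
    using bounded_density_median[OF h_int h0 hR] by blast
  define H where "H = (\<lambda>\<sigma> s. indicator {0<..} s * h (m + \<sigma> * s))"
  have H_int: "integrable lborel (H \<sigma>)" if "\<sigma> = 1 \<or> \<sigma> = -1" for \<sigma>
    unfolding H_def using integrable_mult_indicator[of "{0<..}" lborel "\<lambda>s. h (m + \<sigma> * s)"]
      lborel_integrable_real_affine[OF h_int, of \<sigma> m] that by auto
  define w where "w = (\<lambda>\<sigma>. \<integral>s. H \<sigma> s \<partial>lborel)"
  have w_nn: "(\<integral>\<^sup>+s. ennreal (h (m + \<sigma> * s)) * indicator {0<..} s \<partial>lborel) = ennreal (w \<sigma>)"
    if "\<sigma> = 1 \<or> \<sigma> = -1" for \<sigma>
  proof -
    have "(\<integral>\<^sup>+s. ennreal (h (m + \<sigma> * s)) * indicator {0<..} s \<partial>lborel) = (\<integral>\<^sup>+s. ennreal (H \<sigma> s) \<partial>lborel)"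
      by (intro nn_integral_cong) (simp add: H_def indicator_def)
    also have "\<dots> = ennreal (w \<sigma>)"
      unfolding w_def using H_int[OF that] h0 by (intro nn_integral_eq_integral) (auto simp: H_def)
    finally show ?thesis .
  qed
  have w0: "0 \<le> w \<sigma>" for \<sigma> unfolding w_def using h0 by (intro integral_nonneg_AE) (auto simp: H_def)
  have w_eq: "w (-1) = w 1" using w_nn[of 1] w_nn[of "-1"] m w0 by simp
  \<comment> \<open>The cut is made at \<open>-c\<close>. It is \<open>m\<close> for the marginal
    \<open>h\<close>, and - x.v for the fibre of \<open>f\<close> over \<open>x\<close>.\<close>
  have two_halves: "(\<integral>\<^sup>+\<tau>. u \<tau> \<partial>lborel) = (\<integral>\<^sup>+t. u (1 * t - c) * indicator {0<..} t \<partial>lborel)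
      + (\<integral>\<^sup>+t. u (-1 * t - c) * indicator {0<..} t \<partial>lborel)"
    if [measurable]: "u \<in> borel_measurable borel" for u :: "real \<Rightarrow> ennreal" and c :: real
  proof -
    have "(\<integral>\<^sup>+\<tau>. u \<tau> \<partial>lborel) = (\<integral>\<^sup>+\<tau>. u \<tau> * indicator {-c<..} \<tau> + u \<tau> * indicator {..<-c} \<tau> \<partial>lborel)"
      using AE_lborel_singleton[of "-c"]
      by (intro nn_integral_cong_AE) (auto elim!: eventually_mono simp: indicator_def)
    also have "\<dots> = (\<integral>\<^sup>+\<tau>. u \<tau> * indicator {-c<..} \<tau> \<partial>lborel) + (\<integral>\<^sup>+\<tau>. u \<tau> * indicator {..<-c} \<tau> \<partial>lborel)"
      by (rule nn_integral_add) measurable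
    also have "(\<integral>\<^sup>+\<tau>. u \<tau> * indicator {-c<..} \<tau> \<partial>lborel) = (\<integral>\<^sup>+t. u (1 * t - c) * indicator {0<..} t \<partial>lborel)"
      by (subst nn_integral_real_affine[where c = 1 and t = "-c", of "\<lambda>\<tau>. u \<tau> * indicator {-c<..} \<tau>"])
         (auto simp: indicator_def intro!: nn_integral_cong)
    also have "(\<integral>\<^sup>+\<tau>. u \<tau> * indicator {..<-c} \<tau> \<partial>lborel) = (\<integral>\<^sup>+t. u (-1 * t - c) * indicator {0<..} t \<partial>lborel)"
      by (subst nn_integral_real_affine[where c = "-1" and t = "-c", of "\<lambda>\<tau>. u \<tau> * indicator {..<-c} \<tau>"])
         (auto simp: indicator_def minus_diff_commute intro!: nn_integral_cong)
    finally show ?thesis .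
  qed
  have N: "(\<integral>\<^sup>+x. ennreal (g x) \<partial>lebesgue_PiM ?I) = ennreal (2 * w 1)"
  proof -
    have "(\<integral>\<^sup>+x. ennreal (g x) \<partial>lebesgue_PiM ?I) = (\<integral>\<^sup>+s. (\<integral>\<^sup>+y. ennreal (g (y(k := s))) \<partial>?M) \<partial>lborel)"
      by (rule product_nn_integral_insert_rev) (use J in auto)
    also have "\<dots> = (\<integral>\<^sup>+s. ennreal (h s) \<partial>lborel)" by (simp add: h_nn)
    also have "\<dots> = ennreal (w 1) + ennreal (w (-1))"
      using h_int two_halves[of "\<lambda>s. ennreal (h s)" "-m"] w_nn[of 1] w_nn[of "-1"]
      by (simp add: add.commute borel_measurable_integrable)
    finally show ?thesis using w_eq w0[of 1] by (simp flip: ennreal_plus)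
  qed
  show "\<exists>z. \<forall>f. f \<in> borel_measurable (lebesgue_PiM ?I) \<longrightarrow>
        (\<forall>x\<in>space (lebesgue_PiM ?I). \<forall>y\<in>space (lebesgue_PiM ?I).
           f x * ennreal (g (\<lambda>i\<in>?I. z i + y i)) \<le> ennreal (exp (- (\<Sum>i\<in>?I. x i * y i)))) \<longrightarrow>
        (\<integral>\<^sup>+x. f x \<partial>lebesgue_PiM ?I) * (\<integral>\<^sup>+x. ennreal (g x) \<partial>lebesgue_PiM ?I) \<le> ennreal ((2 * pi) ^ card ?I)"
  proof (cases "w 1 = 0")
    case True
    \<comment> \<open>Here \<open>g\<close> has total mass 0, so every origin works.\<close>
    then show ?thesis unfolding N by simp
  next
    case False
    then have w1: "w 1 > 0" using w0[of 1] by simp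
    \<comment> \<open>Unnormalized first moments of each half: \<open>S\<close> of the distance to
      the hyperplane, \<open>B\<close> of the other coordinates.\<close>
    define S where "S = (\<lambda>\<sigma>. \<integral>s. s * H \<sigma> s \<partial>lborel)"
    define B where "B = (\<lambda>\<sigma> i. \<integral>s. indicator {0<..} s * (\<integral>y. y i * g (y(k := m + \<sigma> * s)) \<partial>?M) \<partial>lborel)"
    have sH_int: "integrable lborel (\<lambda>s. s * H \<sigma> s)" if \<sigma>: "\<sigma> = 1 \<or> \<sigma> = -1" for \<sigma>
    proof (rule Bochner_Integration.integrable_bound)
      show "integrable lborel (\<lambda>s. (\<bar>R\<bar> + \<bar>m\<bar>) * H \<sigma> s)" using H_int[OF \<sigma>] by simp
      show "(\<lambda>s. s * H \<sigma> s) \<in> borel_measurable lborel"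
        using borel_measurable_integrable[OF H_int[OF \<sigma>]] by measurable
      have "\<bar>s * H \<sigma> s\<bar> \<le> \<bar>(\<bar>R\<bar> + \<bar>m\<bar>) * H \<sigma> s\<bar>" for s
      proof (cases "\<bar>s\<bar> \<le> \<bar>R\<bar> + \<bar>m\<bar>")
        case True
        then show ?thesis unfolding abs_mult by (intro mult_right_mono) auto
      next
        case False
        then have "R < \<bar>m + \<sigma> * s\<bar>" using \<sigma> by auto
        then show ?thesis using hR by (simp add: H_def)
      qed
      then show "AE s in lborel. norm (s * H \<sigma> s) \<le> norm ((\<bar>R\<bar> + \<bar>m\<bar>) * H \<sigma> s)" by simp
    qed
    have S0: "S \<sigma> \<ge> 0" for \<sigma>
      unfolding S_def using h0 by (intro integral_nonneg_AE AE_I2) (auto simp: H_def indicator_def)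
    \<comment> \<open>A half of positive mass cannot be concentrated on the hyperplane. This makes
      the denominator in the slope \<open>v\<close> positive.\<close>
    have "S 1 \<noteq> 0"
    proof
      assume "S 1 = 0"
      then have "AE s in lborel. s * H 1 s = 0"
        unfolding S_def using sH_int[of 1] h0
        by (subst (asm) integral_nonneg_eq_0_iff_AE) (auto simp: H_def indicator_def)
      then have "AE s in lborel. H 1 s = 0"
        by eventually_elim (auto simp: H_def indicator_def)
      then have "w 1 = 0" unfolding w_def by (rule integral_eq_zero_AE)
      then show False using w1 by simp
    qed
    then have SS: "S 1 + S (-1) > 0" using S0[of 1] S0[of "-1"] by linarith
    \<comment> \<open>The line \<open>s \<mapsto> (z + s v, m + s)\<close> passes through the barycenters of both halves.\<close>
    define v where "v = (\<lambda>i. (B 1 i - B (-1) i) / (S 1 + S (-1)))"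
    define z where "z = (\<lambda>i. (B 1 i - v i * S 1) / w 1)"
    \<comment> \<open>As both halves have mass \<open>w 1\<close>, subtracting the two equations
      eliminates \<open>z i\<close> and determines \<open>v i\<close>; the equation for \<sigma> = 1
      then gives \<open>z i\<close>. In integrated form, the equations say that the moment of each
      half about the line is 0.\<close>
    have sys: "B \<sigma> i = z i * w \<sigma> + \<sigma> * v i * S \<sigma>" if "\<sigma> = 1 \<or> \<sigma> = -1" for \<sigma> i
    proof -
      have 1: "z i * w 1 = B 1 i - v i * S 1" using w1 by (simp add: z_def)
      have "v i * (S 1 + S (-1)) = B 1 i - B (-1) i" using SS by (simp add: v_def)
      then have "v i * S 1 + v i * S (-1) = B 1 i - B (-1) i" by (simp add: distrib_left)
      then show ?thesis using that 1 w_eq by auto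
    qed
    have bary: "(\<integral>s. indicator {0<..} s *
        (\<integral>y. (y i - (z i + \<sigma> * s * v i)) * g (y(k := m + \<sigma> * s)) \<partial>?M) \<partial>lborel) = 0"
      if \<sigma>: "\<sigma> = 1 \<or> \<sigma> = -1" and i: "i \<in> J" for \<sigma> i
    proof -
      let ?b = "\<lambda>s. indicator {0<..} s * (\<integral>y. y i * g (y(k := m + \<sigma> * s)) \<partial>?M)"
      have int_pair_i: "integrable (lborel \<Otimes>\<^sub>M ?M) (\<lambda>(s, y). indicator {0<..} s * (y i * g (y(k := m + \<sigma> * s))))"
      proof (rule integrable_pair_PiM_box[OF J(1), where B = "\<lambda>_. R" and R = "\<bar>R\<bar> + \<bar>m\<bar>" and C = "R * C"])
        show "(\<lambda>(s, y). indicator {0<..} s * (y i * g (y(k := m + \<sigma> * s)))) \<in> borel_measurable (lborel \<Otimes>\<^sub>M ?M)"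
          using i unfolding case_prod_beta' by measurable
        show "\<bar>(\<lambda>(s, y). indicator {0<..} s * (y i * g (y(k := m + \<sigma> * s)))) (s, x)\<bar> \<le> R * C"
          if "x \<in> Pi\<^sub>E J (\<lambda>i. {- R..R})" for s x
        proof -
          have "\<bar>x i\<bar> \<le> R" using that i by (auto simp: PiE_iff abs_le_iff)
          then show ?thesis using gC C0 by (auto simp: abs_mult indicator_def intro!: mult_mono)
        qed
        show "(\<lambda>(s, y). indicator {0<..} s * (y i * g (y(k := m + \<sigma> * s)))) (s, x) = 0"
          if "x \<in> space ?M" "\<bar>R\<bar> + \<bar>m\<bar> < \<bar>s\<bar>" for s x
        proof -
          have "R < \<bar>m + \<sigma> * s\<bar>" using \<sigma> that(2) by auto
          then show ?thesis using R_k that(1) by simp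
        qed
      qed (use R_J in auto)
      have b_int: "integrable lborel ?b"
        using P.integrable_fst[OF int_pair_i] by simp
      have "indicator {0<..} s * (\<integral>y. (y i - (z i + \<sigma> * s * v i)) * g (y(k := m + \<sigma> * s)) \<partial>?M)
          = ?b s - z i * H \<sigma> s - \<sigma> * v i * (s * H \<sigma> s)" for s
      proof -
        have "(\<integral>y. (y i - (z i + \<sigma> * s * v i)) * g (y(k := m + \<sigma> * s)) \<partial>?M)
          = (\<integral>y. y i * g (y(k := m + \<sigma> * s)) \<partial>?M) - (z i + \<sigma> * s * v i) * h (m + \<sigma> * s)"
          unfolding h_def left_diff_distrib using int_slice int_slice_i[OF i] by simp
        then show ?thesis unfolding H_def by (simp only:) (simp add: indicator_def algebra_simps)
      qed
      then show ?thesis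
        using b_int H_int[OF \<sigma>] sH_int[OF \<sigma>] sys[OF \<sigma>, of i]
        by (simp add: B_def w_def S_def)
    qed
    \<comment> \<open>The witness is \<open>z(k := m)\<close>, the point where the line meets the
      bisecting hyperplane.\<close>
    have "(\<integral>\<^sup>+x. f x \<partial>lebesgue_PiM ?I) * (\<integral>\<^sup>+x. ennreal (g x) \<partial>lebesgue_PiM ?I) \<le> ennreal ((2 * pi) ^ card ?I)"
      if f[measurable]: "f \<in> borel_measurable (lebesgue_PiM ?I)"
      and fg: "\<forall>x\<in>space (lebesgue_PiM ?I). \<forall>y\<in>space (lebesgue_PiM ?I).
           f x * ennreal (g (\<lambda>i\<in>?I. (z(k := m)) i + y i)) \<le> ennreal (exp (- (\<Sum>i\<in>?I. x i * y i)))" for f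
    proof -
      define F where "F = (\<lambda>\<sigma> x. \<integral>\<^sup>+t. f (x(k := \<sigma> * t - (\<Sum>i\<in>J. x i * v i))) * indicator {0<..} t \<partial>lborel)"
      have half: "(\<integral>\<^sup>+x. F \<sigma> x \<partial>?M) * ennreal (w 1) \<le> ennreal (pi / 2 * (2 * pi) ^ card J)"
        if \<sigma>: "\<sigma> = 1 \<or> \<sigma> = -1" for \<sigma>
      proof -
        have "(\<integral>\<^sup>+x. F \<sigma> x \<partial>?M)
          * (\<integral>\<^sup>+s. (\<integral>\<^sup>+y. ennreal (g (y(k := m + \<sigma> * s))) \<partial>?M) * indicator {0<..} s \<partial>lborel)
          \<le> ennreal (pi / 2 * (2 * pi) ^ card J)"
          unfolding F_def
          by (rule half_space_santalo[OF J cent \<sigma> g, where C = C and R = R and z = z])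
             (use gC supp bary[OF \<sigma>] f fg in blast)+
        then show ?thesis unfolding h_nn[symmetric] w_nn[OF \<sigma>] using \<sigma> w_eq by auto
      qed
      have Fm: "F \<sigma> \<in> borel_measurable ?M" for \<sigma>
      proof -
        have [measurable]: "(\<lambda>w. (fst w)(k := \<sigma> * snd w - (\<Sum>i\<in>J. fst w i * v i)))
            \<in> measurable (?M \<Otimes>\<^sub>M lborel) (lebesgue_PiM ?I)"
          by (rule measurable_fun_upd[where J = J]) auto
        have "(\<lambda>(x, t). f (x(k := \<sigma> * t - (\<Sum>i\<in>J. x i * v i))) * indicator {0<..} t) \<in> borel_measurable (?M \<Otimes>\<^sub>M lborel)"
          unfolding case_prod_beta' by measurable
        then show ?thesis unfolding F_def by (rule lborel.borel_measurable_nn_integral)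
      qed
      have "(\<integral>\<^sup>+x. f x \<partial>lebesgue_PiM ?I) = (\<integral>\<^sup>+x. (\<integral>\<^sup>+\<tau>. f (x(k := \<tau>)) \<partial>lborel) \<partial>?M)"
        by (rule product_nn_integral_insert) (use J f in auto)
      \<comment> \<open>Over each \<open>x\<close> the fibre is cut at - x.v, so \<open>f\<close> is
        split by a hyperplane that is in general not parallel to the one splitting
        \<open>g\<close>.\<close>
      also have "\<dots> = (\<integral>\<^sup>+x. F 1 x + F (-1) x \<partial>?M)"
      proof (rule nn_integral_cong)
        fix x assume x: "x \<in> space ?M"
        have "(\<lambda>\<tau>. x(k := \<tau>)) \<in> measurable borel (lebesgue_PiM ?I)"
          using x by (intro measurable_fun_upd[where J = J]) auto
        then have "(\<lambda>\<tau>. f (x(k := \<tau>))) \<in> borel_measurable borel" by measurable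
        then show "(\<integral>\<^sup>+\<tau>. f (x(k := \<tau>)) \<partial>lborel) = F 1 x + F (-1) x"
          unfolding F_def by (rule two_halves)
      qed
      also have "\<dots> = (\<integral>\<^sup>+x. F 1 x \<partial>?M) + (\<integral>\<^sup>+x. F (-1) x \<partial>?M)"
        using Fm by (intro nn_integral_add) auto
      \<comment> \<open>\<open>g\<close> has mass \<open>2 * w 1\<close>, and each half of
        \<open>f\<close> times \<open>w 1\<close> is at most (pi/2) (2 pi)^card J. Together this
        yields one further factor 2 pi.\<close>
      finally have "(\<integral>\<^sup>+x. f x \<partial>lebesgue_PiM ?I) * (\<integral>\<^sup>+x. ennreal (g x) \<partial>lebesgue_PiM ?I)
        = 2 * ((\<integral>\<^sup>+x. F 1 x \<partial>?M) * ennreal (w 1) + (\<integral>\<^sup>+x. F (-1) x \<partial>?M) * ennreal (w 1))"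
        unfolding N using w0[of 1] by (simp add: ennreal_mult distrib_left distrib_right ac_simps)
      also have "\<dots> \<le> 2 * (ennreal (pi / 2 * (2 * pi) ^ card J) + ennreal (pi / 2 * (2 * pi) ^ card J))"
        by (intro mult_left_mono add_mono half) auto
      also have "\<dots> = 2 * ennreal (pi * (2 * pi) ^ card J)"
        by (subst ennreal_plus[symmetric]) (auto simp: mult.commute)
      also have "\<dots> = ennreal (2 * (pi * (2 * pi) ^ card J))"
        by (subst ennreal_mult) auto
      also have "2 * (pi * (2 * pi) ^ card J) = (2 * pi) ^ card ?I" using J by simp
      finally show ?thesis .
    qed
    then show ?thesis by blast
  qed
qed

section \<open>Induction over finite index sets and transfer to Euclidean space\<close>

theorem centered_santalo_finite: "finite I \<Longrightarrow> centered_santalo I"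
proof (induction I rule: finite_induct)
  case empty
  show ?case by (rule centered_santalo_empty)
next
  case (insert k J)
  then show ?case
    by (auto intro: shifted_imp_centered_santalo[OF _ centered_imp_shifted_santalo_insert])
qed

text \<open>\<open>lborel\<close> is the image of the product measure under \<open>T\<close>, which
  assembles a vector from its coordinates in the orthonormal \<open>Basis\<close>. Inner products
  become coordinate sums, and pairing the vector barycenter with basis vectors gives the coordinate
  moments.\<close>

theorem functional_santalo:
  fixes f :: "'a::euclidean_space \<Rightarrow> real" and g :: "'a \<Rightarrow> ennreal"
  assumes f: "integrable lborel f" "\<And>x. 0 \<le> f x"
    and bary: "integrable lborel (\<lambda>x. f x *\<^sub>R x)" "(\<integral>x. f x *\<^sub>R x \<partial>lborel) = 0"
    and g[measurable]: "g \<in> borel_measurable borel"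
    and fg: "\<And>x y. ennreal (f x) * g y \<le> ennreal (exp (- (x \<bullet> y)))"
  shows "(\<integral>\<^sup>+x. ennreal (f x) \<partial>lborel) * (\<integral>\<^sup>+x. g x \<partial>lborel) \<le> ennreal ((2 * pi) ^ DIM('a))"
proof -
  let ?M = "lebesgue_PiM (Basis :: 'a set)"
  define T where "T = (\<lambda>p. \<Sum>b\<in>Basis. p b *\<^sub>R b :: 'a)"
  have [measurable]: "T \<in> borel_measurable ?M" unfolding T_def by measurable
  have lb: "lborel = distr ?M borel T" unfolding T_def by (rule lborel_eq)
  have Tb: "T p \<bullet> b = p b" if "b \<in> Basis" for p b
    using that by (simp add: T_def)
  have [measurable]: "f \<in> borel_measurable borel" using f by auto
  have tr: "integrable ?M (\<lambda>p. h (T p)) \<longleftrightarrow> integrable lborel h" "(\<integral>p. h (T p) \<partial>?M) = (\<integral>x. h x \<partial>lborel)"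
    if "h \<in> borel_measurable borel" for h :: "'a \<Rightarrow> real"
    using that by (simp_all add: lb integrable_distr_eq integral_distr)
  have nn: "(\<integral>\<^sup>+p. h (T p) \<partial>?M) = (\<integral>\<^sup>+x. h x \<partial>lborel)" if "h \<in> borel_measurable borel" for h :: "'a \<Rightarrow> ennreal"
    using that by (simp add: lb nn_integral_distr)
  have "(\<integral>\<^sup>+p. ennreal (f (T p)) \<partial>?M) * (\<integral>\<^sup>+p. g (T p) \<partial>?M) \<le> ennreal ((2 * pi) ^ card (Basis :: 'a set))"
  proof (rule centered_santalo_finite[OF finite_Basis, unfolded centered_santalo_def, rule_format])
    show "integrable ?M (\<lambda>p. f (T p))" using f tr(1)[of f] by simp
    show "0 \<le> f (T p)" for p using f by simp
    show "(\<lambda>p. g (T p)) \<in> borel_measurable ?M" by measurable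
    have int: "integrable lborel (\<lambda>x. (f x *\<^sub>R x) \<bullet> b)" and int0: "(\<integral>x. (f x *\<^sub>R x) \<bullet> b \<partial>lborel) = 0" for b
      using integrable_inner_left[OF bary(1), of b] integral_inner_left[OF bary(1), of b] bary(2)
      by (simp_all del: inner_scaleR_left)
    show "integrable ?M (\<lambda>p. p b * f (T p)) \<and> (\<integral>p. p b * f (T p) \<partial>?M) = 0" if b: "b \<in> Basis" for b
      using tr[of "\<lambda>x. (f x *\<^sub>R x) \<bullet> b"] int[of b] int0[of b] b by (simp add: Tb mult.commute)
    fix p q
    have "T p \<bullet> T q = (\<Sum>b\<in>Basis. p b * q b)"
      by (subst euclidean_inner) (simp add: Tb)
    then show "ennreal (f (T p)) * g (T q) \<le> ennreal (exp (- (\<Sum>b\<in>Basis. p b * q b)))"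
      using fg[of "T p" "T q"] by simp
  qed
  then show ?thesis using nn[of "\<lambda>x. ennreal (f x)"] nn[of g] by simp
qed

section \<open>Gaussian measure\<close>

text \<open>Product structure reduces this to the one-dimensional normal density. The variance is
  left free because |x| exp(-|x|^2/2) will be dominated by a Gaussian with \<sigma> =
  \<open>sqrt 2\<close>.\<close>

lemma nn_integral_gaussian:
  assumes "\<sigma> > 0"
  shows "(\<integral>\<^sup>+x. ennreal (exp (- (norm (x::'a::euclidean_space))\<^sup>2 / (2 * \<sigma>\<^sup>2))) \<partial>lborel) = ennreal (sqrt (2 * pi * \<sigma>\<^sup>2) ^ DIM('a))"
proof -
  have one: "(\<integral>\<^sup>+u. ennreal (exp (- u\<^sup>2 / (2 * \<sigma>\<^sup>2))) \<partial>lborel) = ennreal (sqrt (2 * pi * \<sigma>\<^sup>2))"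
  proof -
    have "(\<integral>\<^sup>+u. ennreal (exp (- u\<^sup>2 / (2 * \<sigma>\<^sup>2))) \<partial>lborel)
      = (\<integral>\<^sup>+u. ennreal (sqrt (2 * pi * \<sigma>\<^sup>2)) * ennreal (normal_density 0 \<sigma> u) \<partial>lborel)"
      using assms by (intro nn_integral_cong) (simp add: normal_density_def flip: ennreal_mult)
    also have "\<dots> = ennreal (sqrt (2 * pi * \<sigma>\<^sup>2)) * (\<integral>\<^sup>+u. ennreal (normal_density 0 \<sigma> u) \<partial>lborel)"
      by (rule nn_integral_cmult) measurable
    also have "(\<integral>\<^sup>+u. ennreal (normal_density 0 \<sigma> u) \<partial>lborel) = 1"
      using assms by (subst nn_integral_eq_integral) auto
    finally show ?thesis by simp
  qed
  have "exp (- (norm x)\<^sup>2 / (2 * \<sigma>\<^sup>2)) = (\<Prod>b\<in>Basis. exp (- (x \<bullet> b)\<^sup>2 / (2 * \<sigma>\<^sup>2)))" for x :: 'a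
  proof -
    have "(norm x)\<^sup>2 = (\<Sum>b\<in>Basis. (x \<bullet> b)\<^sup>2)"
      unfolding power2_norm_eq_inner by (subst euclidean_inner) (simp add: power2_eq_square)
    then show ?thesis by (simp add: sum_divide_distrib sum_negf flip: exp_sum)
  qed
  then have "(\<integral>\<^sup>+x. ennreal (exp (- (norm (x::'a))\<^sup>2 / (2 * \<sigma>\<^sup>2))) \<partial>lborel)
      = (\<integral>\<^sup>+x. (\<Prod>b\<in>Basis. ennreal (exp (- ((x::'a) \<bullet> b)\<^sup>2 / (2 * \<sigma>\<^sup>2)))) \<partial>lborel)"
    by (simp add: prod_ennreal)
  also have "\<dots> = (\<Prod>b\<in>(Basis :: 'a set). (\<integral>\<^sup>+u. ennreal (exp (- u\<^sup>2 / (2 * \<sigma>\<^sup>2))) \<partial>lborel))"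
    by (rule nn_integral_lborel_prod) auto
  also have "\<dots> = ennreal (sqrt (2 * pi * \<sigma>\<^sup>2) ^ DIM('a))"
    unfolding one by (simp add: ennreal_power)
  finally show ?thesis .
qed

lemma integrable_gaussian:
  fixes h :: "'a::euclidean_space \<Rightarrow> 'b::{banach, second_countable_topology}"
  assumes "\<sigma> > 0" "h \<in> borel_measurable borel" "\<And>x. norm (h x) \<le> exp (- (norm x)\<^sup>2 / (2 * \<sigma>\<^sup>2))"
  shows "integrable lborel h"
proof (rule Bochner_Integration.integrable_bound)
  show "integrable lborel (\<lambda>x::'a. exp (- (norm x)\<^sup>2 / (2 * \<sigma>\<^sup>2)))"
    using nn_integral_gaussian[OF assms(1), where 'a = 'a] by (intro integrableI_nonneg) auto
qed (use assms in auto)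

section \<open>Concentration for sets of barycenter 0\<close>

theorem theorem4p1:
  fixes A :: "(real ^ 'n) set" and r :: real
  assumes "A \<in> sets std_gaussian"
    and "measure std_gaussian A > 0"
    and "set_lebesgue_integral std_gaussian A (\<lambda>x. x) = 0"
    and "r \<ge> 0"
  shows "1 - measure std_gaussian (nbhd A r)
           \<le> inverse (measure std_gaussian A) * exp (- r\<^sup>2 / 2)"
proof -
  define e where "e = (\<lambda>x::real^'n. exp (- (norm x)\<^sup>2 / 2))"
  define c where "c = (2 * pi) powr (- real DIM(real^'n) / 2)"
  have [measurable]: "e \<in> borel_measurable borel" unfolding e_def by measurable
  have c0: "c > 0" by (simp add: c_def)
  have e0: "0 \<le> e x" for x by (simp add: e_def)
  \<comment> \<open>Each of the two Gaussian masses carries a factor \<open>c\<close>; their product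
    cancels the constant of \<open>functional_santalo\<close> exactly.\<close>
  have c2: "c\<^sup>2 * (2 * pi) ^ DIM(real^'n) = 1"
  proof -
    have "c\<^sup>2 = (2 * pi) powr (- real DIM(real^'n))"
      by (simp add: c_def powr_power)
    also have "\<dots> = inverse ((2 * pi) ^ DIM(real^'n))"
      by (simp only: powr_minus powr_realpow) (simp add: powr_realpow)
    finally show ?thesis by (simp only:) (rule left_inverse, simp)
  qed
  have sg: "(std_gaussian :: (real^'n) measure) = density lebesgue (\<lambda>x. ennreal (c * e x))"
    by (simp add: std_gaussian_def c_def e_def)
  have dm: "(\<lambda>x. ennreal (c * e x)) \<in> borel_measurable lebesgue"
    by (rule measurable_completion) measurable
  have em: "emeasure std_gaussian S = ennreal c * (\<integral>\<^sup>+x. ennreal (e x) * indicator S x \<partial>lborel)"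
    if "S \<in> sets borel" for S :: "(real^'n) set"
  proof -
    have "emeasure std_gaussian S = (\<integral>\<^sup>+x. ennreal (c * e x) * indicator S x \<partial>lebesgue)"
      unfolding sg using that dm by (intro emeasure_density) auto
    also have "\<dots> = (\<integral>\<^sup>+x. ennreal c * (ennreal (e x) * indicator S x) \<partial>lborel)"
      unfolding nn_integral_completion using c0 e0
      by (intro nn_integral_cong) (simp add: ennreal_mult ac_simps)
    also have "\<dots> = ennreal c * (\<integral>\<^sup>+x. ennreal (e x) * indicator S x \<partial>lborel)"
      using that by (intro nn_integral_cmult) auto
    finally show ?thesis .
  qed
  have "emeasure std_gaussian (UNIV :: (real^'n) set) = ennreal (c * sqrt (2 * pi) ^ DIM(real^'n))"
    using em[of UNIV] nn_integral_gaussian[of 1, where 'a = "real^'n"] c0 by (simp add: e_def ennreal_mult)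
  also have "c * sqrt (2 * pi) ^ DIM(real^'n) = 1"
  \<comment> \<open>Both sides are nonnegative, and comparing squares avoids half-integer powers of
    2 pi.\<close>
  proof (rule power2_eq_imp_eq)
    show "(c * sqrt (2 * pi) ^ DIM(real^'n))\<^sup>2 = 1\<^sup>2"
      using c2 by (simp add: power_mult_distrib flip: power_mult mult.commute[of 2])
         (simp add: power_mult real_sqrt_pow2)
  qed (use c0 in auto)
  finally interpret prob_space "std_gaussian :: (real^'n) measure"
    by (intro prob_spaceI) (simp add: sg)
  have sets_sg: "sets (std_gaussian :: (real^'n) measure) = sets lebesgue" by (simp add: sg)
  \<comment> \<open>\<open>functional_santalo\<close> needs Borel functions, but \<open>A\<close> is only Lebesgue measurable.\<close>
  obtain S N N' where SN: "A = S \<union> N" "N \<subseteq> N'" "N' \<in> null_sets lborel" "S \<in> sets lborel"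
    using assms(1) unfolding sets_sg by (rule sets_completionE)
  have [measurable]: "S \<in> sets borel" using SN by simp
  have AE_lb: "AE x in lebesgue. x \<in> A \<longleftrightarrow> x \<in> S"
  proof (rule AE_completion, rule AE_I')
    show "{x \<in> space lborel. \<not> (x \<in> A \<longleftrightarrow> x \<in> S)} \<subseteq> N'" using SN by auto
  qed fact
  then have AE_sg: "AE x in std_gaussian. x \<in> A \<longleftrightarrow> x \<in> S"
    unfolding sg using dm by (subst AE_density) (auto elim: eventually_mono)
  have mA: "prob A = prob S"
    using AE_sg assms(1) SN sets_sg by (intro measure_eq_AE) auto
  define K where "K = nbhd A r"
  have "closed K" unfolding K_def nbhd_def
    by (intro closed_Collect_le continuous_intros)
  then have [measurable]: "K \<in> sets borel" by (rule borel_closed)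
  define f where "f = (\<lambda>x. indicator S x * e x)"
  define g where "g = (\<lambda>y. ennreal (exp (r\<^sup>2 / 2)) * (ennreal (e y) * indicator (- K) y))"
  have fm[measurable]: "f \<in> borel_measurable borel" unfolding f_def by measurable
  have "integrable lborel f"
    by (rule integrable_gaussian[of 1]) (auto simp: f_def e_def indicator_def)
  \<comment> \<open>Integrability does not follow from the barycenter hypothesis, since a Bochner
    integral defaults to 0; it comes from a Gaussian majorant.\<close>
  moreover have int_bary: "integrable lborel (\<lambda>x. f x *\<^sub>R x)"
  proof (rule integrable_gaussian[of "sqrt 2"])
    fix x :: "real^'n"
    \<comment> \<open>The linear factor is at most exp(|x|^2/4), which leaves exp(-|x|^2/4), the
      Gaussian with \<sigma> = \<open>sqrt 2\<close>.\<close>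
    have "norm x \<le> 1 + (norm x / 2)\<^sup>2"
      using zero_le_power2[of "norm x / 2 - 1"] by (simp add: power2_eq_square field_simps)
    also have "\<dots> \<le> exp ((norm x / 2)\<^sup>2)" by (rule exp_ge_add_one_self)
    finally have "norm x * e x \<le> exp ((norm x / 2)\<^sup>2) * e x" using e0 by (intro mult_right_mono)
    also have "\<dots> = exp (- (norm x)\<^sup>2 / (2 * (sqrt 2)\<^sup>2))"
      unfolding e_def by (simp add: power_divide field_simps flip: exp_add)
    finally show "norm (f x *\<^sub>R x) \<le> exp (- (norm x)\<^sup>2 / (2 * (sqrt 2)\<^sup>2))"
      using e0[of x] by (auto simp: f_def indicator_def mult.commute)
  qed auto
  moreover have "(\<integral>x. f x *\<^sub>R x \<partial>lborel) = 0"
  proof -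
    have im: "(\<lambda>x. indicator D x *\<^sub>R x) \<in> borel_measurable lebesgue"
      if "D \<in> sets lebesgue" for D :: "(real^'n) set"
      using that by (intro borel_measurable_scaleR borel_measurable_indicator measurable_completion) auto
    have S: "S \<in> sets lebesgue" by (simp add: sets_completionI_sets)
    \<comment> \<open>The hypothesis is carried from \<open>A\<close> to the Borel set
      \<open>S\<close>, equal to it almost everywhere, and then from the density to
      \<open>lborel\<close>, where it reads \<open>c\<close> times the barycenter integral of
      \<open>f\<close>.\<close>
    have "0 = (\<integral>x. indicator A x *\<^sub>R x \<partial>std_gaussian)"
      using assms(3) by (simp add: set_lebesgue_integral_def)
    also have "\<dots> = (\<integral>x. indicator S x *\<^sub>R x \<partial>std_gaussian)"
    proof (rule integral_cong_AE)
      show "(\<lambda>x. indicator A x *\<^sub>R x) \<in> borel_measurable std_gaussian"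
        "(\<lambda>x. indicator S x *\<^sub>R x) \<in> borel_measurable std_gaussian"
        using im[of A] im[OF S] assms(1) by (simp_all add: sg)
      show "AE x in std_gaussian. indicator A x *\<^sub>R x = indicator S x *\<^sub>R x"
        using AE_sg by eventually_elim (auto simp: indicator_def)
    qed
    also have "\<dots> = (\<integral>x. (c * e x) *\<^sub>R (indicator S x *\<^sub>R x) \<partial>lebesgue)"
      unfolding sg using c0 e0 im[OF S]
      by (intro integral_density) (auto intro!: measurable_completion)
    also have "\<dots> = (\<integral>x. (c * e x) *\<^sub>R (indicator S x *\<^sub>R x) \<partial>lborel)"
      by (rule integral_completion) measurable
    also have "\<dots> = c *\<^sub>R (\<integral>x. f x *\<^sub>R x \<partial>lborel)"
      by (simp add: f_def ac_simps flip: integral_scaleR_right)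
    finally show ?thesis using c0 by simp
  qed
  moreover have "ennreal (f x) * g y \<le> ennreal (exp (- (x \<bullet> y)))" for x y
  proof (cases "x \<in> S \<and> y \<notin> K")
    case True
    then have "x \<in> A" "infdist y A > r" using SN by (auto simp: K_def nbhd_def)
    then have "r < dist y x" using infdist_le less_le_trans by fast
    \<comment> \<open>Expanding |y - x|^2 turns the distance bound into the kernel bound: r^2/2 -
      |x|^2/2 - |y|^2/2 <= -x.y. Outside this case \<open>f x\<close> or \<open>g y\<close> is
      0.\<close>
    then have "r\<^sup>2 \<le> (norm (y - x))\<^sup>2" using assms(4) by (intro power_mono) (auto simp: dist_norm)
    also have "\<dots> = (norm x)\<^sup>2 + (norm y)\<^sup>2 - 2 * (x \<bullet> y)"
      by (simp add: power2_norm_eq_inner inner_diff_left inner_diff_right inner_commute)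
    finally have "r\<^sup>2 / 2 - (norm x)\<^sup>2 / 2 - (norm y)\<^sup>2 / 2 \<le> - (x \<bullet> y)" by simp
    then have "e x * (exp (r\<^sup>2 / 2) * e y) \<le> exp (- (x \<bullet> y))"
      unfolding e_def by (simp add: algebra_simps flip: exp_add)
    then show ?thesis
      using True e0 by (auto simp: f_def g_def intro!: ennreal_leI simp flip: ennreal_mult)
  qed (auto simp: f_def g_def indicator_def)
  moreover have [measurable]: "g \<in> borel_measurable borel" unfolding g_def by measurable
  ultimately have fg: "(\<integral>\<^sup>+x. ennreal (f x) \<partial>lborel) * (\<integral>\<^sup>+x. g x \<partial>lborel) \<le> ennreal ((2 * pi) ^ DIM(real^'n))"
    using e0 by (intro functional_santalo) (auto simp: f_def)
  have cf: "ennreal c * (\<integral>\<^sup>+x. ennreal (f x) \<partial>lborel) = ennreal (prob S)"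
    using em[of S] e0 unfolding emeasure_eq_measure f_def
    by (simp add: ennreal_mult mult.commute ennreal_indicator)
  have cg: "ennreal c * (\<integral>\<^sup>+x. g x \<partial>lborel) = ennreal (exp (r\<^sup>2 / 2) * prob (- K))"
    using em[of "- K"] unfolding emeasure_eq_measure g_def
    by (subst nn_integral_cmult) (auto simp: ennreal_mult ac_simps)
  have "ennreal (prob S) * ennreal (exp (r\<^sup>2 / 2) * prob (- K))
      = ennreal (c\<^sup>2) * ((\<integral>\<^sup>+x. ennreal (f x) \<partial>lborel) * (\<integral>\<^sup>+x. g x \<partial>lborel))"
    unfolding cf[symmetric] cg[symmetric] using c0 by (simp add: power2_eq_square ennreal_mult ac_simps)
  also have "\<dots> \<le> ennreal (c\<^sup>2) * ennreal ((2 * pi) ^ DIM(real^'n))"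
    by (rule mult_left_mono[OF fg]) simp
  also have "\<dots> = 1" by (subst ennreal_mult[symmetric]) (simp_all only: c2, auto)
  finally have "prob S * (exp (r\<^sup>2 / 2) * prob (- K)) \<le> 1"
    by (simp flip: ennreal_mult add: ennreal_le_1)
  moreover have "prob (- K) = 1 - prob K"
    using prob_compl[of K] by (simp add: sg Compl_eq_Diff_UNIV)
  ultimately show ?thesis
    using assms(2) unfolding mA K_def by (simp add: exp_minus field_simps)
qed

end
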